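(* If $h:\mathcal P_2(\mathbb R^n\times U)\to\mathbb R$ is Lipschitz continuous, then so is its extension $\tilde h:\mathcal P_2(\mathbb R^n\times\mathcal P(U))\to\mathbb R$ defined by $$\tilde h(\xi):=h(\mathscr P(\xi)),\qquad\mathscr P(\xi)(dx,du):=\int_{\mathcal P(U)}q(du)\,\xi(dx,dq).$$
   Context: $(B,\|\cdot\|)$ is a Banach space, $U\subset B$ compact; $\mathbb R^n\times B$ carries the norm $|x|+\|u\|$. $\mathcal P(E)$ (resp. $\mathcal P_2(E)$): Borel probability measures on $E$ (with finite second moment). $\mathrm{Lip}_1(E)$: real functions on $E$ with Lipschitz constant at most $1$. $\mathcal M(U)$: finite signed Radon measures on $U$ with the Fortet–Mourier norm $\|q\|_{U,\rm FM}=\sup\{\int_Uf\,dq:f\in\mathrm{Lip}_1(U),\|f\|_\infty\le1\}$; $\mathcal P(U)\subset\mathcal M(U)$ has the induced metric. $V=\mathbb R^n\times\mathcal M(U)$ has norm $|x|+\|q\|_{U,\rm FM}$. $\mathcal P_2(\mathbb R^n\times U)$ carries the metric induced by $\|\rho\|_{K,\rm FM}=\sup\{\int f\,d\rho:f\in\mathrm{Lip}_1(\mathbb R^n\times B),\|f\|_\infty\le1\}$. $\mathcal P_2(\mathbb R^n\times\mathcal P(U))$, identified with the elements of $\mathcal P_2(V)$ supported in $\mathbb R^n\times\mathcal P(U)$, carries the Kantorovich–Rubinstein metric $d_{\rm KR}(\xi_1,\xi_2)=\sup_{f\in\mathrm{Lip}_1(V)}(\int f\,d\xi_1-\int f\,d\xi_2)$.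 Lipschitz continuity is with respect to these metrics. $\mathscr P$ maps $\mathcal P_2(\mathbb R^n\times\mathcal P(U))$ into $\mathcal P_2(\mathbb R^n\times U)$. *)

theory Defs
  imports "HOL-Probability.Probability"
begin

section \<open>Finite signed Radon measures\<close>

text \<open>Signed measures are real set functions, extended by 0 to non-measurable sets so that equality
  of signed measures is equality of functions (the convention of \<^const>\<open>measure\<close>).\<close>

definition signed_measure :: "'a measure \<Rightarrow> ('a set \<Rightarrow> real) \<Rightarrow> bool" where
  "signed_measure M q \<longleftrightarrow>
     (\<forall>A. A \<notin> sets M \<longrightarrow> q A = 0) \<and>
     (\<forall>A :: nat \<Rightarrow> 'a set. range A \<subseteq> sets M \<longrightarrow> disjoint_family A \<longrightarrow>
        (\<lambda>i. q (A i)) sums q (\<Union>i. A i))"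

definition pos_variation :: "'a measure \<Rightarrow> ('a set \<Rightarrow> real) \<Rightarrow> 'a measure" where
  "pos_variation M q =
     measure_of (space M) (sets M) (\<lambda>A. SUP B\<in>{B \<in> sets M. B \<subseteq> A}. ennreal (q B))"

definition neg_variation :: "'a measure \<Rightarrow> ('a set \<Rightarrow> real) \<Rightarrow> 'a measure" where
  "neg_variation M q = pos_variation M (\<lambda>A. - q A)"

definition signed_integral :: "'a measure \<Rightarrow> ('a set \<Rightarrow> real) \<Rightarrow> ('a \<Rightarrow> real) \<Rightarrow> real" where
  "signed_integral M q f =
     (\<integral>x. f x \<partial>pos_variation M q) - (\<integral>x. f x \<partial>neg_variation M q)"

definition radon :: "'a::topological_space measure \<Rightarrow> bool" where
  "radon \<mu> \<longleftrightarrow>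
     (\<forall>A \<in> sets \<mu>. emeasure \<mu> A = (SUP K\<in>{K. compact K \<and> K \<subseteq> A}. emeasure \<mu> K))"

definition borel_on :: "'a::topological_space set \<Rightarrow> 'a measure" where
  "borel_on E = restrict_space borel E"

definition signed_radon :: "'a::topological_space set \<Rightarrow> ('a set \<Rightarrow> real) set" where
  "signed_radon U =
     {q. signed_measure (borel_on U) q \<and>
         radon (pos_variation (borel_on U) q) \<and> radon (neg_variation (borel_on U) q)}"

text \<open>Borel probability measures on \<open>U\<close>, as elements of \<^term>\<open>signed_radon U\<close>.\<close>

definition prob_on :: "'a::topological_space set \<Rightarrow> ('a set \<Rightarrow> real) set" where
  "prob_on U = measure ` {\<mu>. prob_space \<mu> \<and> sets \<mu> = sets (borel_on U)}"


section \<open>Lipschitz functions and Fortet--Mourier norms\<close>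

definition Lip1 :: "'a set \<Rightarrow> ('a \<Rightarrow> 'a \<Rightarrow> real) \<Rightarrow> ('a \<Rightarrow> real) set" where
  "Lip1 X d = {f. \<forall>x\<in>X. \<forall>y\<in>X. \<bar>f x - f y\<bar> \<le> d x y}"

definition Lipschitz_continuous_wrt ::
    "'a set \<Rightarrow> ('a \<Rightarrow> 'a \<Rightarrow> real) \<Rightarrow> ('a \<Rightarrow> real) \<Rightarrow> bool" where
  "Lipschitz_continuous_wrt X d h \<longleftrightarrow> (\<exists>L\<ge>0. \<forall>x\<in>X. \<forall>y\<in>X. \<bar>h x - h y\<bar> \<le> L * d x y)"

text \<open>In \<open>fm_norm E X d q\<close> the signed measure \<open>q\<close> lives on \<open>E\<close>, while the test functions are
  Lipschitz and bounded on \<open>X \<supseteq> E\<close>.\<close>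

definition fm_norm ::
    "'a::topological_space set \<Rightarrow> 'a set \<Rightarrow> ('a \<Rightarrow> 'a \<Rightarrow> real) \<Rightarrow> ('a set \<Rightarrow> real) \<Rightarrow> real" where
  "fm_norm E X d q =
     (SUP f\<in>{f \<in> Lip1 X d. \<forall>x\<in>X. \<bar>f x\<bar> \<le> 1}. signed_integral (borel_on E) q f)"

text \<open>The norm of a product \<open>\<real>\<^sup>n \<times> B\<close> of type \<open>(real ^ 'n) \<times> 'b\<close> in the library is the Euclidean one;
  here the sum norm is used. The two induce the same topology, hence the same Borel sets.\<close>

definition sum_norm :: "'a::real_normed_vector \<times> 'b::real_normed_vector \<Rightarrow> real" where
  "sum_norm p = norm (fst p) + norm (snd p)"

definition sum_dist ::
    "'a::real_normed_vector \<times> 'b::real_normed_vector \<Rightarrow> 'a \<times> 'b \<Rightarrow> real" where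
  "sum_dist p p' = sum_norm (p - p')"

definition fm_norm_U :: "'b::banach set \<Rightarrow> ('b set \<Rightarrow> real) \<Rightarrow> real" where
  "fm_norm_U U q = fm_norm U U dist q"

definition fm_norm_K ::
    "'b::banach set \<Rightarrow> (((real ^ 'n) \<times> 'b) set \<Rightarrow> real) \<Rightarrow> real" where
  "fm_norm_K U q = fm_norm (UNIV \<times> U) UNIV sum_dist q"


section \<open>The space \<open>\<P>\<^sub>2(\<real>\<^sup>n \<times> U)\<close>\<close>

definition P2_states :: "'b::banach set \<Rightarrow> ((real ^ 'n) \<times> 'b) measure set" where
  "P2_states U =
     {\<rho>. prob_space \<rho> \<and> sets \<rho> = sets (borel_on (UNIV \<times> U)) \<and>
         integrable \<rho> (\<lambda>p. (sum_norm p)\<^sup>2)}"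

definition fm_dist_K ::
    "'b::banach set \<Rightarrow> ((real ^ 'n) \<times> 'b) measure \<Rightarrow> ((real ^ 'n) \<times> 'b) measure \<Rightarrow> real" where
  "fm_dist_K U \<rho>1 \<rho>2 = fm_norm_K U (\<lambda>A. measure \<rho>1 A - measure \<rho>2 A)"


section \<open>The space \<open>\<P>\<^sub>2(\<real>\<^sup>n \<times> \<P>(U))\<close>\<close>

definition V_space :: "'b::banach set \<Rightarrow> ((real ^ 'n) \<times> ('b set \<Rightarrow> real)) set" where
  "V_space U = UNIV \<times> signed_radon U"

definition V_norm :: "'b::banach set \<Rightarrow> (real ^ 'n) \<times> ('b set \<Rightarrow> real) \<Rightarrow> real" where
  "V_norm U v = norm (fst v) + fm_norm_U U (snd v)"

definition V_dist ::
    "'b::banach set \<Rightarrow> (real ^ 'n) \<times> ('b set \<Rightarrow> real) \<Rightarrow> (real ^ 'n) \<times> ('b set \<Rightarrow> real) \<Rightarrow> real" where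
  "V_dist U v w = V_norm U (fst v - fst w, \<lambda>A. snd v A - snd w A)"

definition metric_borel :: "'a set \<Rightarrow> ('a \<Rightarrow> 'a \<Rightarrow> real) \<Rightarrow> 'a measure" where
  "metric_borel X d =
     sigma X {W. W \<subseteq> X \<and> (\<forall>x\<in>W. \<exists>e>0. \<forall>y\<in>X. d x y < e \<longrightarrow> y \<in> W)}"

text \<open>Measures on \<open>\<real>\<^sup>n \<times> \<P>(U)\<close> take the place of measures on \<open>V\<close> supported there, so
  \<open>\<integral> f d\<xi>\<close> for \<open>f\<close> on \<open>V\<close> only involves the restriction of \<open>f\<close>.\<close>

definition P2_relaxed ::
    "'b::banach set \<Rightarrow> ((real ^ 'n) \<times> ('b set \<Rightarrow> real)) measure set" where
  "P2_relaxed U =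
     {\<xi>. prob_space \<xi> \<and> sets \<xi> = sets (metric_borel (UNIV \<times> prob_on U) (V_dist U)) \<and>
         integrable \<xi> (\<lambda>v. (V_norm U v)\<^sup>2)}"

definition KR_dist ::
    "'b::banach set \<Rightarrow> ((real ^ 'n) \<times> ('b set \<Rightarrow> real)) measure \<Rightarrow>
     ((real ^ 'n) \<times> ('b set \<Rightarrow> real)) measure \<Rightarrow> real" where
  "KR_dist U \<xi>1 \<xi>2 =
     (SUP f\<in>Lip1 (V_space U) (V_dist U). (\<integral>v. f v \<partial>\<xi>1) - (\<integral>v. f v \<partial>\<xi>2))"


section \<open>The averaging map and the extension\<close>

text \<open>The measure \<open>\<integral> q(du) \<xi>(dx,dq)\<close> gives a Borel set \<open>A\<close> the mass
  \<open>\<integral> q(A\<^sub>x) \<xi>(dx,dq)\<close>, with \<open>A\<^sub>x\<close> the section of \<open>A\<close> at \<open>x\<close>.\<close>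

definition average ::
    "'b::banach set \<Rightarrow> ((real ^ 'n) \<times> ('b set \<Rightarrow> real)) measure \<Rightarrow> ((real ^ 'n) \<times> 'b) measure" where
  "average U \<xi> =
     measure_of (UNIV \<times> U) (sets (borel_on (UNIV \<times> U)))
       (\<lambda>A. \<integral>\<^sup>+ (x, q). ennreal (q {u. (x, u) \<in> A}) \<partial>\<xi>)"

definition extend ::
    "'b::banach set \<Rightarrow> (((real ^ 'n) \<times> 'b) measure \<Rightarrow> real) \<Rightarrow>
     ((real ^ 'n) \<times> ('b set \<Rightarrow> real)) measure \<Rightarrow> real" where
  "extend U h \<xi> = h (average U \<xi>)"

end

theory Submission
  imports Defs
begin

text \<open>A test function \<open>f\<close> on \<open>\<real>\<^sup>n \<times> B\<close> for the Fortet--Mourier norm induces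
  \<open>F (x, q) = \<integral> f (x, u) q(du)\<close>, and integrating \<open>f\<close> against \<open>\<P>(\<xi>)\<close> is integrating \<open>F\<close> against \<open>\<xi>\<close>.
  On \<open>\<real>\<^sup>n \<times> \<P>(U)\<close> the function \<open>F\<close> is 1-Lipschitz, so it extends to a 1-Lipschitz function on \<open>V\<close>
  that competes in the supremum defining the Kantorovich--Rubinstein distance. Hence averaging does
  not increase distances, and the extension inherits the Lipschitz constant of \<open>h\<close>.\<close>

text \<open>Both distances are suprema of reals, which dominate their terms only when the family is
  bounded above. For the Fortet--Mourier norm this needs finite total variation, hence the
  boundedness of countably additive real set functions; for \<open>KR_dist\<close> it needs first
  moments in \<open>x\<close> and a finite diameter of \<open>prob_on U\<close>. Integration against
  a signed measure is defined through its variations, so its additivity in the measure rests on the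
  Jordan decomposition. \<open>average\<close> is built by \<open>measure_of\<close>, which
  collapses to the null measure if the given set function is not a measure; identifying it with a
  bind rules this out. The kernel in that bind must be shown measurable for a sigma-algebra known
  only through \<open>V_dist\<close>, and Lipschitz functions are the bridge. That
  \<open>prob_on U\<close> lies in V at all depends on finite Borel measures on a compact set being
  Radon. Since \<open>h\<close> is controlled only on \<open>P2_states U\<close>, the average must
  also have a finite second moment.\<close>

section \<open>The Jordan decomposition\<close>

lemma signed_measure_sums:
  "signed_measure M q \<Longrightarrow> range A \<subseteq> sets M \<Longrightarrow> disjoint_family A \<Longrightarrow> (\<lambda>i. q (A i)) sums q (\<Union>i. A i)"
  for A :: "nat \<Rightarrow> 'a set"
  by (auto simp: signed_measure_def)

text \<open>The empty set is the disjoint union of infinitely many copies of itself, and a constant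
  series converges only if its term is 0.\<close>

lemma signed_measure_empty: "signed_measure M q \<Longrightarrow> q {} = 0"
  using signed_measure_sums[of M q "\<lambda>_. {}"]
  by (auto simp: disjoint_family_on_def summable_const_iff dest!: sums_summable)

lemma signed_measure_Un:
  assumes "signed_measure M q" "A \<in> sets M" "B \<in> sets M" "A \<inter> B = {}"
  shows "q (A \<union> B) = q A + q B"
proof -
  have "disjoint_family (binaryset A B)" "range (binaryset A B) \<subseteq> sets M"
    using assms by (auto simp: disjoint_family_on_def binaryset_def)
  from signed_measure_sums[OF assms(1) this(2,1)] binaryset_sums[of q A B, OF signed_measure_empty[OF assms(1)]]
  show ?thesis by (simp add: UN_binaryset_eq sums_unique2)
qed

lemma signed_measure_Diff:
  assumes "signed_measure M q" "A \<in> sets M" "B \<in> sets M" "B \<subseteq> A"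
  shows "q (A - B) = q A - q B"
  using signed_measure_Un[OF assms(1), of B "A - B"] assms by (auto simp: Un_absorb1)

lemma signed_measure_uminus: "signed_measure M q \<Longrightarrow> signed_measure M (\<lambda>A. - q A)"
  by (auto simp: signed_measure_def intro!: sums_minus)

lemma signed_measure_minus:
  "signed_measure M p \<Longrightarrow> signed_measure M q \<Longrightarrow> signed_measure M (\<lambda>A. p A - q A)"
  by (auto simp: signed_measure_def intro!: sums_diff)

lemma (in finite_measure) signed_measure_measure: "signed_measure M (measure M)"
  by (auto simp: signed_measure_def measure_notin_sets intro!: finite_measure_UNION)

text \<open>Otherwise one could halve a set of unbounded variation repeatedly, cutting off disjoint pieces of
  mass at least 1.\<close>

lemma signed_measure_bounded:
  assumes q: "signed_measure M q"
  shows "\<exists>C. \<forall>A\<in>sets M. \<bar>q A\<bar> \<le> C"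
proof (rule ccontr)
  assume unbounded: "\<not> ?thesis"
  define bad where "bad A \<longleftrightarrow> A \<in> sets M \<and> (\<forall>C. \<exists>B\<in>sets M. B \<subseteq> A \<and> C < \<bar>q B\<bar>)" for A
  have "bad (space M)"
  proof -
    have "\<exists>B\<in>sets M. B \<subseteq> space M \<and> C < \<bar>q B\<bar>" for C
      using unbounded sets.sets_into_space[of _ M] by (meson not_le)
    then show ?thesis by (simp add: bad_def)
  qed
  moreover have "\<exists>A'. bad A' \<and> A' \<subseteq> A \<and> 1 \<le> \<bar>q (A - A')\<bar>" if "bad A" for A
  proof -
    have A: "A \<in> sets M" using that by (simp add: bad_def)
    \<comment> \<open>The margin \<open>1 + \<bar>q A\<bar>\<close> makes both \<open>B\<close> and
      \<open>A - B\<close> have value at least 1 in absolute value, so whichever half stays bad, the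
      discarded half is large.\<close>
    obtain B where B: "B \<in> sets M" "B \<subseteq> A" "1 + \<bar>q A\<bar> < \<bar>q B\<bar>"
      using \<open>bad A\<close> unfolding bad_def by blast
    have "bad B \<or> bad (A - B)"
    proof (rule ccontr)
      assume "\<not> (bad B \<or> bad (A - B))"
      then obtain C D where C: "\<And>E. E \<in> sets M \<Longrightarrow> E \<subseteq> B \<Longrightarrow> \<bar>q E\<bar> \<le> C"
        and D: "\<And>E. E \<in> sets M \<Longrightarrow> E \<subseteq> A - B \<Longrightarrow> \<bar>q E\<bar> \<le> D"
        unfolding bad_def using A B(1) sets.Diff[OF A B(1)] by (meson not_le)
      obtain E where E: "E \<in> sets M" "E \<subseteq> A" "C + D < \<bar>q E\<bar>"
        using \<open>bad A\<close> unfolding bad_def by blast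
      have "q E = q (E \<inter> B) + q (E - B)"
        using signed_measure_Un[OF q, of "E \<inter> B" "E - B"] E B by (auto simp: Int_Diff_Un)
      moreover have "\<bar>q (E \<inter> B)\<bar> \<le> C" "\<bar>q (E - B)\<bar> \<le> D"
        using E B by (auto intro!: C D)
      ultimately show False using E(3) by linarith
    qed
    moreover have "1 \<le> \<bar>q (A - B)\<bar>" "1 \<le> \<bar>q (A - (A - B))\<bar>"
      using signed_measure_Diff[OF q A B(1,2)] B by (auto simp: double_diff)
    ultimately show ?thesis using B(2) by blast
  qed
  ultimately obtain A where A: "\<And>n::nat. bad (A n)" "\<And>n. A (Suc n) \<subseteq> A n"
      "\<And>n. 1 \<le> \<bar>q (A n - A (Suc n))\<bar>"
    using dependent_nat_choice[of "\<lambda>_. bad" "\<lambda>_ A A'. A' \<subseteq> A \<and> 1 \<le> \<bar>q (A - A')\<bar>"] by metis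
  have mono: "n \<le> m \<Longrightarrow> A m \<subseteq> A n" for m n
    by (rule lift_Suc_antimono_le[of A]) (use A(2) in auto)
  have "disjoint_family (\<lambda>n. A n - A (Suc n))"
  proof -
    have "(A m - A (Suc m)) \<inter> (A n - A (Suc n)) = {}" if "m < n" for m n
      using mono[of "Suc m" n] that by auto
    then show ?thesis
      unfolding disjoint_family_on_def by (metis Int_commute nat_neq_iff)
  qed
  moreover have "range (\<lambda>n. A n - A (Suc n)) \<subseteq> sets M"
    using A(1) by (auto simp: bad_def)
  ultimately have "(\<lambda>n. q (A n - A (Suc n))) \<longlonglongrightarrow> 0"
    using signed_measure_sums[OF q] sums_summable summable_LIMSEQ_zero by blast
  then have "eventually (\<lambda>n. \<bar>q (A n - A (Suc n))\<bar> < 1) sequentially"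
    using tendsto_rabs_zero order_tendstoD(2) zero_less_one by blast
  then show False
    using A(3) by (auto simp: eventually_sequentially not_less[symmetric])
qed

section \<open>The positive and negative variations as finite measures\<close>

lemma sets_pos_variation [simp]: "sets (pos_variation M q) = sets M"
  and space_pos_variation [simp]: "space (pos_variation M q) = space M"
  by (simp_all add: pos_variation_def sets.space_closed sets.sigma_sets_eq)

lemma measurable_pos_variation [simp]: "measurable (pos_variation M q) N = measurable M N"
  by (rule measurable_cong_sets) simp_all

lemma sets_neg_variation [simp]: "sets (neg_variation M q) = sets M"
  and space_neg_variation [simp]: "space (neg_variation M q) = space M"
  by (simp_all add: neg_variation_def)

text \<open>What has to be shown is countable additivity of the supremum formula, without which
  \<open>measure_of\<close> would yield the null measure. Superadditivity on disjoint sets and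
  monotonicity give one inequality; for the other, a competitor \<open>B\<close> is cut along the
  sequence \<open>F\<close> and the countable additivity of \<open>q\<close> is used.\<close>

lemma emeasure_pos_variation:
  assumes q: "signed_measure M q" and A: "A \<in> sets M"
  shows "emeasure (pos_variation M q) A = (SUP B\<in>{B \<in> sets M. B \<subseteq> A}. ennreal (q B))"
proof -
  define P where "P A = (SUP B\<in>{B \<in> sets M. B \<subseteq> A}. ennreal (q B))" for A
  note q0 = signed_measure_empty[OF q]
  have max0: "ennreal (max 0 r) = ennreal r" for r :: real
    by (cases "0 \<le> r") (auto simp: max_def ennreal_neg)
  have upper: "ennreal (q B) \<le> P A" if "B \<in> sets M" "B \<subseteq> A" for A B
    unfolding P_def using that by (intro SUP_upper) auto
  have P0: "P {} = 0"
    unfolding P_def using q0 by (auto intro!: antisym SUP_least)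
  have mono: "P A \<le> P B" if "A \<subseteq> B" for A B
    unfolding P_def using that by (intro SUP_subset_mono) auto
  have super: "P A + P B \<le> P (A \<union> B)" if AB: "A \<inter> B = {}" for A B
  proof -
    have ne: "{B \<in> sets M. B \<subseteq> A} \<noteq> {}" for A by auto
    have "ennreal (q C) + ennreal (q D) \<le> P (A \<union> B)"
      if C: "C \<in> sets M" "C \<subseteq> A" and D: "D \<in> sets M" "D \<subseteq> B" for C D
    proof -
      \<comment> \<open>\<open>ennreal\<close> truncates negative values to 0 and is additive only
        on nonnegative ones. A competitor of negative value is therefore replaced by the empty set,
        which has the same truncated value.\<close>
      define C' D' where "C' = (if 0 \<le> q C then C else {})" and "D' = (if 0 \<le> q D then D else {})"
      have "ennreal (q C) + ennreal (q D) = ennreal (q C') + ennreal (q D')"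
        using q0 by (auto simp: C'_def D'_def ennreal_neg)
      also have "\<dots> = ennreal (q C' + q D')"
        using q0 by (auto simp: C'_def D'_def)
      also have "\<dots> = ennreal (q (C' \<union> D'))"
        using C D AB by (subst signed_measure_Un[OF q]) (auto simp: C'_def D'_def)
      also have "\<dots> \<le> P (A \<union> B)"
        using C D by (intro upper) (auto simp: C'_def D'_def)
      finally show ?thesis .
    qed
    then show ?thesis
      unfolding P_def[of A] P_def[of B]
      by (subst ennreal_SUP_add_left[OF ne, symmetric], intro SUP_least,
          subst ennreal_SUP_add_right[OF ne], intro SUP_least) auto
  qed
  have "countably_additive (sets M) P"
  proof (rule countably_additiveI, rule antisym)
    fix F :: "nat \<Rightarrow> 'a set" assume F: "range F \<subseteq> sets M" "disjoint_family F"
    have "sum (\<lambda>i. P (F i)) {..<n} \<le> P (\<Union>i<n. F i)" for n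
    proof (induction n)
      case (Suc n)
      have "(\<Union>i<n. F i) \<inter> F n = {}"
      proof -
        have "F i \<inter> F n = {}" if "i < n" for i
          using disjoint_family_onD[OF F(2), of i n] that by simp
        then show ?thesis by blast
      qed
      have "sum (\<lambda>i. P (F i)) {..<Suc n} \<le> P (\<Union>i<n. F i) + P (F n)"
        using Suc by (simp add: add_right_mono)
      also have "\<dots> \<le> P ((\<Union>i<n. F i) \<union> F n)" by (rule super) fact
      finally show ?case by (simp add: lessThan_Suc Un_commute)
    qed (simp add: P0)
    then have "sum (\<lambda>i. P (F i)) {..<n} \<le> P (\<Union>i. F i)" for n
      using mono[of "\<Union>i<n. F i" "\<Union>i. F i"] by (blast intro: order.trans)
    then show "(\<Sum>i. P (F i)) \<le> P (\<Union>i. F i)"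
      by (intro suminf_le_const) auto
    show "P (\<Union>i. F i) \<le> (\<Sum>i. P (F i))"
      unfolding P_def[of "\<Union>i. F i"]
    proof (rule SUP_least, clarify)
      fix B assume B: "B \<in> sets M" "B \<subseteq> (\<Union>i. F i)"
      have "(\<lambda>i. q (B \<inter> F i)) sums q (\<Union>i. B \<inter> F i)"
        using F B by (intro signed_measure_sums[OF q]) (auto simp: disjoint_family_on_def)
      moreover have "(\<Union>i. B \<inter> F i) = B" using B by auto
      ultimately have "(\<lambda>n. \<Sum>i<n. q (B \<inter> F i)) \<longlonglongrightarrow> q B" by (simp add: sums_def)
      then have "(\<lambda>n. ennreal (\<Sum>i<n. q (B \<inter> F i))) \<longlonglongrightarrow> ennreal (q B)" by simp
      moreover have "ennreal (\<Sum>i<n. q (B \<inter> F i)) \<le> (\<Sum>i. P (F i))" for n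
      proof -
        have "ennreal (\<Sum>i<n. q (B \<inter> F i)) \<le> ennreal (\<Sum>i<n. max 0 (q (B \<inter> F i)))"
          by (intro ennreal_leI sum_mono) auto
        also have "\<dots> = (\<Sum>i<n. ennreal (q (B \<inter> F i)))"
          by (subst sum_ennreal[symmetric]) (simp_all add: max0)
        also have "\<dots> \<le> (\<Sum>i<n. P (F i))"
          using B F by (intro sum_mono upper) auto
        also have "\<dots> \<le> (\<Sum>i. P (F i))"
          by (intro sum_le_suminf) auto
        finally show ?thesis .
      qed
      ultimately show "ennreal (q B) \<le> (\<Sum>i. P (F i))"
        by (intro LIMSEQ_le_const2) auto
    qed
  qed
  then show ?thesis
    unfolding P_def pos_variation_def using A P0
    by (subst emeasure_measure_of_sigma) (auto simp: positive_def P_def sets.sigma_algebra_axioms)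
qed

lemma finite_measure_pos_variation:
  assumes q: "signed_measure M q"
  shows "finite_measure (pos_variation M q)"
proof -
  obtain C where "\<And>A. A \<in> sets M \<Longrightarrow> \<bar>q A\<bar> \<le> C"
    using signed_measure_bounded[OF q] by auto
  then have "emeasure (pos_variation M q) (space M) \<le> ennreal C"
    unfolding emeasure_pos_variation[OF q sets.top]
    by (intro SUP_least ennreal_leI) (auto simp: abs_le_iff)
  then show ?thesis
    by (intro finite_measureI) (auto simp: top_unique)
qed

lemma finite_measure_neg_variation: "signed_measure M q \<Longrightarrow> finite_measure (neg_variation M q)"
  unfolding neg_variation_def by (intro finite_measure_pos_variation signed_measure_uminus)

text \<open>For \<open>B\<close> inside \<open>A\<close>, \<open>q B = q A - q (A - B)\<close>, and
  \<open>- q (A - B)\<close> is at most the negative variation of \<open>A\<close>. The supremum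
  over \<open>B\<close> gives one inequality; the same argument for \<open>- q\<close> gives the
  other.\<close>

lemma jordan_decomposition:
  assumes q: "signed_measure M q" and A: "A \<in> sets M"
  shows "q A = measure (pos_variation M q) A - measure (neg_variation M q) A"
proof -
  have *: "measure (pos_variation M q) A \<le> q A + measure (pos_variation M (\<lambda>A. - q A)) A"
    if q: "signed_measure M q" for q
  proof -
    interpret P: finite_measure "pos_variation M q"
      by (rule finite_measure_pos_variation[OF q])
    interpret N: finite_measure "pos_variation M (\<lambda>A. - q A)"
      by (rule finite_measure_pos_variation[OF signed_measure_uminus[OF q]])
    have N: "- q B \<le> measure (pos_variation M (\<lambda>A. - q A)) A" if "B \<in> sets M" "B \<subseteq> A" for B
    proof -
      have "ennreal (- q B) \<le> emeasure (pos_variation M (\<lambda>A. - q A)) A"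
        unfolding emeasure_pos_variation[OF signed_measure_uminus[OF q] A] using that
        by (intro SUP_upper) auto
      then show ?thesis
        by (simp add: N.emeasure_eq_measure ennreal_le_iff)
    qed
    have "emeasure (pos_variation M q) A \<le> ennreal (q A + measure (pos_variation M (\<lambda>A. - q A)) A)"
      unfolding emeasure_pos_variation[OF q A]
    proof (intro SUP_least ennreal_leI, clarify)
      fix B assume B: "B \<in> sets M" "B \<subseteq> A"
      then show "q B \<le> q A + measure (pos_variation M (\<lambda>A. - q A)) A"
        using signed_measure_Diff[OF q A B] N[of "A - B"] A by auto
    qed
    then show ?thesis
      using N[of A] A by (simp add: P.emeasure_eq_measure ennreal_le_iff)
  qed
  from *[OF q] *[OF signed_measure_uminus[OF q]] show ?thesis
    by (simp add: neg_variation_def)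
qed

text \<open>An element of \<open>prob_on U\<close> is only a set function; this is how the measure
  behind it is recovered, so that one can integrate against it.\<close>

lemma pos_variation_measure:
  assumes "finite_measure \<mu>" "sets \<mu> = sets M"
  shows "pos_variation M (measure \<mu>) = \<mu>"
proof (rule measure_eqI)
  interpret finite_measure \<mu> by fact
  have sm: "signed_measure M (measure \<mu>)"
    using signed_measure_measure assms(2) by (simp add: signed_measure_def)
  fix A assume "A \<in> sets (pos_variation M (measure \<mu>))"
  then have A: "A \<in> sets M" by simp
  show "emeasure (pos_variation M (measure \<mu>)) A = emeasure \<mu> A"
    unfolding emeasure_pos_variation[OF sm A] emeasure_eq_measure[symmetric]
    using A assms(2) by (intro antisym SUP_least) (auto intro!: emeasure_mono SUP_upper)
qed (use assms in auto)

lemma emeasure_neg_variation_measure: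
  assumes "finite_measure \<mu>" "sets \<mu> = sets M" "A \<in> sets M"
  shows "emeasure (neg_variation M (measure \<mu>)) A = 0"
proof -
  interpret finite_measure \<mu> by fact
  have "signed_measure M (measure \<mu>)"
    using signed_measure_measure assms(2) by (simp add: signed_measure_def)
  from emeasure_pos_variation[OF signed_measure_uminus[OF this] assms(3)]
  show ?thesis
    by (auto simp: neg_variation_def ennreal_neg intro!: antisym SUP_least)
qed


section \<open>Integration against signed measures\<close>

text \<open>An identity between signed measures, with the negative terms moved across, becomes an
  identity between sums of positive measures. In that form it passes to integrals by induction over
  nonnegative measurable functions.\<close>

lemma nn_integral_sum_measures_cong:
  assumes fin: "finite I" "finite J"
    and sets: "\<And>i. i \<in> I \<Longrightarrow> sets (M i) = sets S" "\<And>j. j \<in> J \<Longrightarrow> sets (N j) = sets S"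
    and eq: "\<And>A. A \<in> sets S \<Longrightarrow> (\<Sum>i\<in>I. emeasure (M i) A) = (\<Sum>j\<in>J. emeasure (N j) A)"
    and f: "f \<in> borel_measurable S"
  shows "(\<Sum>i\<in>I. \<integral>\<^sup>+x. f x \<partial>M i) = (\<Sum>j\<in>J. \<integral>\<^sup>+x. f x \<partial>N j)"
  using f
proof (induction rule: borel_measurable_induct)
  case (cong f g)
  moreover have "(\<integral>\<^sup>+x. f x \<partial>L) = (\<integral>\<^sup>+x. g x \<partial>L)" if "sets L = sets S" for L
    using cong sets_eq_imp_space_eq[OF that] by (intro nn_integral_cong) auto
  ultimately show ?case using sets by simp
next
  case (set A)
  with eq[OF set] sets show ?case by simp
next
  case (mult u c)
  moreover have "(\<integral>\<^sup>+x. c * u x \<partial>L) = c * (\<integral>\<^sup>+x. u x \<partial>L)" if "sets L = sets S" for L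
    by (intro nn_integral_cmult) (simp add: mult measurable_cong_sets[OF that refl])
  ultimately show ?case using sets by (simp flip: sum_distrib_left)
next
  case (add u v)
  moreover have "(\<integral>\<^sup>+x. v x + u x \<partial>L) = (\<integral>\<^sup>+x. v x \<partial>L) + (\<integral>\<^sup>+x. u x \<partial>L)" if "sets L = sets S" for L
    by (intro nn_integral_add) (simp_all add: add measurable_cong_sets[OF that refl])
  ultimately show ?case using sets by (simp add: sum.distrib)
next
  case (seq U)
  have "(\<integral>\<^sup>+x. (SUP i. U i x) \<partial>L) = (SUP i. \<integral>\<^sup>+x. U i x \<partial>L)" if "sets L = sets S" for L
    by (intro nn_integral_monotone_convergence_SUP) (simp_all add: seq measurable_cong_sets[OF that refl])
  moreover have "incseq (\<lambda>i. \<integral>\<^sup>+x. U i x \<partial>L)" for L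
    using seq by (auto intro!: nn_integral_mono simp: incseq_def le_fun_def)
  ultimately show ?case
    using sets seq by (simp add: image_comp SUP_apply flip: ennreal_SUP_sum)
qed

text \<open>The previous lemma is applied to the positive and the negative part of \<open>f\<close>;
  integrability keeps all values finite, so that \<open>enn2real\<close> commutes with the
  sums.\<close>

lemma integral_sum_measures_cong:
  fixes f :: "'a \<Rightarrow> real" and I J :: "'i set"
  assumes fin: "finite I" "finite J"
    and sets: "\<And>i. i \<in> I \<Longrightarrow> sets (M i) = sets S" "\<And>j. j \<in> J \<Longrightarrow> sets (N j) = sets S"
    and eq: "\<And>A. A \<in> sets S \<Longrightarrow> (\<Sum>i\<in>I. emeasure (M i) A) = (\<Sum>j\<in>J. emeasure (N j) A)"
    and int: "\<And>i. i \<in> I \<Longrightarrow> integrable (M i) f" "\<And>j. j \<in> J \<Longrightarrow> integrable (N j) f"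
    and f: "f \<in> borel_measurable S"
  shows "(\<Sum>i\<in>I. \<integral>x. f x \<partial>M i) = (\<Sum>j\<in>J. \<integral>x. f x \<partial>N j)"
proof -
  have *: "(\<Sum>i\<in>I. enn2real (\<integral>\<^sup>+x. g x \<partial>M i)) = enn2real (\<Sum>i\<in>I. \<integral>\<^sup>+x. g x \<partial>M i)"
    if "\<And>i. i \<in> I \<Longrightarrow> (\<integral>\<^sup>+x. g x \<partial>M i) < top" for g and I :: "'i set" and M :: "'i \<Rightarrow> 'a measure"
    using that by (simp add: enn2real_sum)
  have fin_pos: "(\<integral>\<^sup>+x. ennreal (f x) \<partial>L) < top" "(\<integral>\<^sup>+x. ennreal (- f x) \<partial>L) < top"
    if "integrable L f" for L
    using integrableD[OF that] by (auto simp: less_top)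
  show ?thesis
    using int nn_integral_sum_measures_cong[OF fin sets eq, of "\<lambda>x. ennreal (f x)"]
      nn_integral_sum_measures_cong[OF fin sets eq, of "\<lambda>x. ennreal (- f x)"] f
    by (simp add: real_lebesgue_integral_def sum_subtractf * fin_pos)
qed

lemma (in finite_measure) integrable_bounded_on_space:
  fixes f :: "'a \<Rightarrow> real"
  assumes "f \<in> borel_measurable M" "\<And>x. x \<in> space M \<Longrightarrow> \<bar>f x\<bar> \<le> C"
  shows "integrable M f"
  using assms by (intro integrable_const_bound[of _ C]) auto

text \<open>The variations of \<open>p - q\<close> are not the differences of those of
  \<open>p\<close> and \<open>q\<close>. Writing r = p - q and marking variations by + and -, the
  three Jordan decompositions still give r+ + p- + q+ = r- + p+ + q-, and a bounded \<open>f\<close>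
  is integrable against all six finite measures.\<close>

lemma signed_integral_diff:
  assumes p: "signed_measure M p" and q: "signed_measure M q"
    and f: "f \<in> borel_measurable M" and C: "\<And>x. x \<in> space M \<Longrightarrow> \<bar>f x\<bar> \<le> C"
  shows "signed_integral M (\<lambda>A. p A - q A) f = signed_integral M p f - signed_integral M q f"
proof -
  define r where "r = (\<lambda>A. p A - q A)"
  note r = signed_measure_minus[OF p q, folded r_def]
  let ?L = "[pos_variation M r, neg_variation M p, pos_variation M q]"
  let ?R = "[neg_variation M r, pos_variation M p, neg_variation M q]"
  have fin: "finite_measure L" if "L \<in> set ?L \<union> set ?R" for L
    using that p q r by (auto intro: finite_measure_pos_variation finite_measure_neg_variation)
  have sets: "sets L = sets M" if "L \<in> set ?L \<union> set ?R" for L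
    using that by auto
  have int: "integrable L f" if "L \<in> set ?L \<union> set ?R" for L
    using C f sets[OF that] sets_eq_imp_space_eq[OF sets[OF that]]
    by (intro finite_measure.integrable_bounded_on_space[OF fin[OF that], of f C])
      (auto cong: measurable_cong_sets)
  have "(\<Sum>i\<in>{..<3}. \<integral>x. f x \<partial>(?L ! i)) = (\<Sum>i\<in>{..<3}. \<integral>x. f x \<partial>(?R ! i))"
  proof (rule integral_sum_measures_cong[where S = M])
    fix A assume A: "A \<in> sets M"
    have e: "emeasure L A = ennreal (measure L A)" if "L \<in> set ?L \<union> set ?R" for L
      using finite_measure.emeasure_eq_measure[OF fin[OF that]] .
    have "measure (pos_variation M r) A + measure (neg_variation M p) A + measure (pos_variation M q) A =
      measure (neg_variation M r) A + measure (pos_variation M p) A + measure (neg_variation M q) A"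
      using jordan_decomposition[OF p A] jordan_decomposition[OF q A] jordan_decomposition[OF r A]
      by (simp add: r_def)
    then show "(\<Sum>i\<in>{..<3}. emeasure (?L ! i) A) = (\<Sum>i\<in>{..<3}. emeasure (?R ! i) A)"
      by (simp add: eval_nat_numeral e del: ennreal_plus flip: ennreal_plus)
  next
    fix i :: nat assume "i \<in> {..<3}"
    then have "?L ! i \<in> set ?L" "?R ! i \<in> set ?R" by (auto intro!: nth_mem simp del: set_simps)
    then show "sets (?L ! i) = sets M" "sets (?R ! i) = sets M"
       "integrable (?L ! i) f" "integrable (?R ! i) f"
      by (metis UnI1 sets, metis UnI2 sets, metis UnI1 int, metis UnI2 int)
  qed (use f in auto)
  then show ?thesis
    unfolding signed_integral_def r_def[symmetric] by (simp add: eval_nat_numeral)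
qed

lemma signed_integral_measure:
  assumes "finite_measure \<mu>" "sets \<mu> = sets M"
  shows "signed_integral M (measure \<mu>) f = (\<integral>x. f x \<partial>\<mu>)"
proof -
  have "neg_variation M (measure \<mu>) = null_measure M"
    using emeasure_neg_variation_measure[OF assms] by (intro measure_eqI) auto
  then show ?thesis
    by (simp add: signed_integral_def pos_variation_measure[OF assms])
qed

text \<open>Its use is that the supremum in the Fortet--Mourier norm is over a set bounded above. A
  non-integrable \<open>f\<close> has integral 0 by convention and satisfies the bound
  trivially.\<close>

lemma abs_signed_integral_le:
  assumes q: "signed_measure M q" and f: "\<And>x. x \<in> space M \<Longrightarrow> \<bar>f x\<bar> \<le> 1"
  shows "\<bar>signed_integral M q f\<bar> \<le>
    measure (pos_variation M q) (space M) + measure (neg_variation M q) (space M)"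
proof -
  have "\<bar>\<integral>x. f x \<partial>L\<bar> \<le> measure L (space L)" if "finite_measure L" "space L = space M" for L
  proof (cases "integrable L f")
    case True
    interpret finite_measure L by fact
    have "\<bar>\<integral>x. f x \<partial>L\<bar> \<le> (\<integral>x. \<bar>f x\<bar> \<partial>L)" by (rule integral_abs_bound)
    also have "\<dots> \<le> (\<integral>x. 1 \<partial>L)"
      using True f that by (intro integral_mono) auto
    finally show ?thesis by simp
  qed (simp add: not_integrable_integral_eq)
  from this[OF finite_measure_pos_variation[OF q]] this[OF finite_measure_neg_variation[OF q]]
  show ?thesis by (auto simp: signed_integral_def)
qed


section \<open>Probability measures on a compact set are Radon\<close>

lemma space_borel_on [simp]: "space (borel_on E) = E"
  by (simp add: borel_on_def space_restrict_space)

lemma sets_borel_on_closed: "closed E \<Longrightarrow> A \<in> sets (borel_on E) \<longleftrightarrow> A \<subseteq> E \<and> A \<in> sets borel"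
  by (simp add: borel_on_def sets_restrict_space_iff)

lemma compact_countable_dense:
  fixes S :: "'a::metric_space set"
  assumes "compact S"
  shows "\<exists>D. countable D \<and> D \<subseteq> S \<and> (\<forall>x\<in>S. \<forall>e>0. \<exists>d\<in>D. dist x d < e)"
proof -
  have "\<exists>k. finite k \<and> k \<subseteq> S \<and> S \<subseteq> (\<Union>x\<in>k. ball x (inverse (Suc n)))" for n
    using seq_compact_imp_totally_bounded[OF compact_imp_seq_compact[OF assms]] by simp
  then obtain k where k: "\<And>n. finite (k n)" "\<And>n. k n \<subseteq> S"
      "\<And>n. S \<subseteq> (\<Union>x\<in>k n. ball x (inverse (Suc n)))"
    by metis
  have "\<exists>d\<in>(\<Union>n. k n). dist x d < e" if x: "x \<in> S" and e: "e > 0" for x e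
  proof -
    obtain n where n: "inverse (real (Suc n)) < e" using reals_Archimedean[OF e] by auto
    obtain d where "d \<in> k n" "dist d x < inverse (Suc n)" using k(3)[of n] x by auto
    with n show ?thesis by (auto simp: dist_commute intro!: bexI[of _ d])
  qed
  with k show ?thesis
    by (intro exI[of _ "\<Union>n. k n"]) (auto intro: countable_finite)
qed

text \<open>Inner regularity is known on Polish spaces. The ambient space need not be separable, but a
  compact subset embeds into the Polish space of real sequences.\<close>

lemma compact_embedding:
  fixes U :: "'a::metric_space set"
  assumes "compact U"
  shows "\<exists>e :: 'a \<Rightarrow> nat \<Rightarrow> real. continuous_on U e \<and> inj_on e U"
proof (cases "U = {}")
  case False
  obtain D where D: "countable D" "D \<subseteq> U" "\<And>x e. x \<in> U \<Longrightarrow> e > 0 \<Longrightarrow> \<exists>d\<in>D. dist x d < e"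
    using compact_countable_dense[OF assms] by blast
  have "D \<noteq> {}" using False D(3)[of _ 1] by auto
  \<comment> \<open>Distances to a dense sequence separate points: a dense \<open>d\<close> with
    \<open>dist x d < dist x y / 2\<close> cannot be equally far from \<open>x\<close> and
    \<open>y\<close>.\<close>
  define e where "e x n = dist x (from_nat_into D n)" for x n
  have "continuous_on U e"
    unfolding e_def by (intro continuous_on_coordinatewise_then_product continuous_intros)
  moreover have "inj_on e U"
  proof (rule inj_onI, rule ccontr)
    fix x y assume xy: "x \<in> U" "y \<in> U" "e x = e y" "x \<noteq> y"
    obtain d where d: "d \<in> D" "dist x d < dist x y / 2" using D(3)[of x "dist x y / 2"] xy by auto
    obtain n where "d = from_nat_into D n" using from_nat_into_surj[OF D(1) d(1)] by auto
    then have "dist x d = dist y d" using fun_cong[OF xy(3), of n] by (simp add: e_def)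
    then show False using d(2) dist_triangle3[of x y d] by (simp add: dist_commute)
  qed
  ultimately show ?thesis by blast
qed auto

text \<open>Inner regularity is applied to the image measure \<open>\<nu>\<close> on the sequence
  space. Compact sets are carried back along the inverse \<open>g\<close>, which is continuous
  because \<open>U\<close> is compact.\<close>

lemma radon_compact:
  fixes U :: "'a::metric_space set"
  assumes U: "compact U" and \<mu>: "finite_measure \<mu>" "sets \<mu> = sets (borel_on U)"
  shows "radon \<mu>"
  unfolding radon_def
proof
  interpret finite_measure \<mu> by fact
  have space: "space \<mu> = U" using sets_eq_imp_space_eq[OF \<mu>(2)] by simp
  note sets_U = sets_borel_on_closed[OF compact_imp_closed[OF U]]
  fix A assume "A \<in> sets \<mu>"
  then have A: "A \<subseteq> U" "A \<in> sets borel" by (auto simp: \<mu>(2) sets_U)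
  obtain e :: "'a \<Rightarrow> nat \<Rightarrow> real" where e: "continuous_on U e" "inj_on e U"
    using compact_embedding[OF U] by blast
  obtain g where g: "homeomorphism U (e ` U) e g"
    using homeomorphism_compact[OF U e(1) refl e(2)] by blast
  have eU: "compact (e ` U)" by (rule compact_continuous_image[OF e(1) U])
  have cg: "continuous_on (e ` U) g" and ge: "\<And>x. x \<in> U \<Longrightarrow> g (e x) = x"
    using g by (auto simp: homeomorphism_def)
  have e_meas: "e \<in> measurable \<mu> borel"
    using borel_measurable_continuous_on_restrict[OF e(1)] measurable_cong_sets[OF \<mu>(2) refl]
    by (auto simp: borel_on_def)
  define \<nu> where "\<nu> = distr \<mu> borel e"
  have \<nu>: "emeasure \<nu> B = emeasure \<mu> {x \<in> U. e x \<in> B}" if "B \<in> sets borel" for B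
    unfolding \<nu>_def using e_meas that by (subst emeasure_distr) (auto simp: space intro!: arg_cong[where f = "emeasure \<mu>"])
  have pre: "{x \<in> U. e x \<in> e ` C} = C" if "C \<subseteq> U" for C
    using that e(2) by (auto simp: inj_on_def)
  \<comment> \<open>The image of \<open>A\<close> is the preimage of \<open>A\<close> under
    \<open>g\<close>, taken within the closed set of all values of \<open>e\<close> on
    \<open>U\<close>.\<close>
  have "e ` A \<in> sets borel"
  proof -
    have "g -` A \<inter> space (restrict_space borel (e ` U)) \<in> sets (restrict_space borel (e ` U))"
      by (rule measurable_sets[OF borel_measurable_continuous_on_restrict[OF cg] A(2)])
    moreover have "g -` A \<inter> space (restrict_space borel (e ` U)) = e ` A"
      using A(1) ge by (auto simp: space_restrict_space)
    ultimately show ?thesis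
      using compact_imp_closed[OF eU] by (simp add: sets_restrict_space_iff)
  qed
  moreover have "emeasure \<nu> (space \<nu>) \<noteq> \<infinity>"
    by (simp add: \<nu>_def \<nu>[unfolded \<nu>_def])
  ultimately have "emeasure \<nu> (e ` A) = (SUP K\<in>{K. K \<subseteq> e ` A \<and> compact K}. emeasure \<nu> K)"
    by (intro inner_regular) (simp_all add: \<nu>_def)
  moreover have "emeasure \<nu> (e ` A) = emeasure \<mu> A"
    using \<nu> pre[OF A(1)] \<open>e ` A \<in> sets borel\<close> by simp
  moreover have "(SUP K\<in>{K. K \<subseteq> e ` A \<and> compact K}. emeasure \<nu> K) \<le>
    (SUP K\<in>{K. compact K \<and> K \<subseteq> A}. emeasure \<mu> K)"
  proof (rule SUP_least, clarify)
    fix K assume K: "K \<subseteq> e ` A" "compact K"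
    have sub: "g ` K \<subseteq> A" using K(1) A(1) ge by (force simp: subset_iff)
    have "K = e ` g ` K" using K(1) A(1) ge by (force simp: image_iff)
    then have "emeasure \<nu> K = emeasure \<mu> (g ` K)"
      using \<nu>[of K] pre[of "g ` K"] sub A(1) K(2) by (auto simp: compact_imp_closed)
    moreover have "compact (g ` K)"
      using K A(1) by (intro compact_continuous_image continuous_on_subset[OF cg]) auto
    ultimately show "emeasure \<nu> K \<le> (SUP K\<in>{K. compact K \<and> K \<subseteq> A}. emeasure \<mu> K)"
      using sub by (auto intro!: SUP_upper)
  qed
  moreover have "(SUP K\<in>{K. compact K \<and> K \<subseteq> A}. emeasure \<mu> K) \<le> emeasure \<mu> A"
    using A by (intro SUP_least emeasure_mono) (auto simp: \<mu>(2) sets_U)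
  ultimately show "emeasure \<mu> A = (SUP K\<in>{K. compact K \<and> K \<subseteq> A}. emeasure \<mu> K)"
    by (auto intro: antisym)
qed

lemma prob_onD:
  assumes "q \<in> prob_on U"
  shows "prob_space (pos_variation (borel_on U) q)" "measure (pos_variation (borel_on U) q) = q"
    "signed_measure (borel_on U) q"
proof -
  obtain \<mu> where \<mu>: "prob_space \<mu>" "sets \<mu> = sets (borel_on U)" "q = measure \<mu>"
    using assms by (auto simp: prob_on_def)
  interpret prob_space \<mu> by fact
  have "pos_variation (borel_on U) q = \<mu>"
    unfolding \<mu>(3) by (rule pos_variation_measure[OF finite_measure_axioms \<mu>(2)])
  then show "prob_space (pos_variation (borel_on U) q)" "measure (pos_variation (borel_on U) q) = q"
    using \<mu> by auto
  show "signed_measure (borel_on U) q"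
    using signed_measure_measure \<mu>(2,3) by (simp add: signed_measure_def)
qed

lemma signed_integral_prob_on:
  "q \<in> prob_on U \<Longrightarrow> signed_integral (borel_on U) q f = (\<integral>x. f x \<partial>pos_variation (borel_on U) q)"
  using signed_integral_measure[of "pos_variation (borel_on U) q" "borel_on U" f] prob_onD[of q U]
  by (simp add: prob_space.finite_measure)

text \<open>This places the domain of the averaged test functions inside \<open>V_space U\<close>,
  where the test functions of \<open>KR_dist\<close> live.\<close>

lemma prob_on_subset_signed_radon:
  fixes U :: "'a::metric_space set"
  assumes "compact U"
  shows "prob_on U \<subseteq> signed_radon U"
  using assms prob_onD(3)
  by (auto simp: signed_radon_def intro!: radon_compact finite_measure_pos_variation finite_measure_neg_variation)


section \<open>Lipschitz functions and the Fortet--Mourier norm\<close>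

lemma Lip1D: "f \<in> Lip1 X d \<Longrightarrow> x \<in> X \<Longrightarrow> y \<in> X \<Longrightarrow> \<bar>f x - f y\<bar> \<le> d x y"
  by (simp add: Lip1_def)

lemma Lip1_uminus: "f \<in> Lip1 X d \<Longrightarrow> (\<lambda>x. - f x) \<in> Lip1 X d"
  by (auto simp: Lip1_def abs_minus_commute)

lemma borel_measurable_Lip1:
  assumes "f \<in> Lip1 U dist"
  shows "f \<in> borel_measurable (borel_on U)"
proof -
  have "\<bar>f y - f x\<bar> < e" if "x \<in> U" "y \<in> U" "dist y x < e" for x y e
    using Lip1D[OF assms that(2,1)] that by simp
  then have "continuous_on U f"
    unfolding continuous_on_iff dist_real_def by blast
  then show ?thesis
    unfolding borel_on_def by (rule borel_measurable_continuous_on_restrict)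
qed

text \<open>The preimage of an open set is open for \<open>d\<close>, hence one of the generators.
  This is the source of all measurability statements on pairs \<open>(x, q)\<close>.\<close>

lemma borel_measurable_Lip1_metric_borel:
  assumes "f \<in> Lip1 X d"
  shows "f \<in> borel_measurable (metric_borel X d)"
proof (rule borel_measurableI)
  fix S :: "real set" assume S: "open S"
  let ?G = "{W. W \<subseteq> X \<and> (\<forall>x\<in>W. \<exists>e>0. \<forall>y\<in>X. d x y < e \<longrightarrow> y \<in> W)}"
  have "?G \<subseteq> Pow X" by auto
  then have space: "space (metric_borel X d) = X" and sets: "sets (metric_borel X d) = sigma_sets X ?G"
    by (simp_all add: metric_borel_def)
  have "f -` S \<inter> X \<in> ?G"
  proof (intro CollectI conjI ballI)
    fix x assume x: "x \<in> f -` S \<inter> X"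
    then obtain e where e: "e > 0" "\<And>y. \<bar>y - f x\<bar> < e \<Longrightarrow> y \<in> S"
      using S unfolding open_dist dist_real_def by blast
    have "y \<in> f -` S \<inter> X" if "y \<in> X" "d x y < e" for y
      using Lip1D[OF assms, of x y] x that by (auto intro!: e(2) simp: abs_minus_commute)
    with e(1) show "\<exists>e>0. \<forall>y\<in>X. d x y < e \<longrightarrow> y \<in> f -` S \<inter> X" by blast
  qed auto
  then show "f -` S \<inter> space (metric_borel X d) \<in> sets (metric_borel X d)"
    unfolding space sets by (rule sigma_sets.Basic)
qed

lemma Lip1_McShane_extension:
  assumes S: "S \<subseteq> X" "S \<noteq> {}" and F: "F \<in> Lip1 S d"
    and sym: "\<And>x y. x \<in> X \<Longrightarrow> y \<in> X \<Longrightarrow> d x y = d y x"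
    and tri: "\<And>x y z. x \<in> X \<Longrightarrow> y \<in> X \<Longrightarrow> z \<in> X \<Longrightarrow> d x z \<le> d x y + d y z"
    and refl: "\<And>x. x \<in> S \<Longrightarrow> d x x = 0"
  shows "\<exists>G\<in>Lip1 X d. \<forall>x\<in>S. G x = F x"
proof -
  \<comment> \<open>McShane's formula, the largest 1-Lipschitz extension. For any fixed
    \<open>s\<close> in \<open>S\<close> the triangle inequality bounds the infimum below by
    \<open>F s - d s v\<close>.\<close>
  define G where "G v = (INF w\<in>S. F w + d v w)" for v
  have bdd: "bdd_below ((\<lambda>w. F w + d v w) ` S)" if v: "v \<in> X" for v
  proof -
    obtain s where s: "s \<in> S" using S(2) by auto
    have "F s - d s v \<le> F w + d v w" if "w \<in> S" for w
      using Lip1D[OF F s that] tri[of s v w] s that v S(1) by force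
    then show ?thesis by (rule bdd_belowI2)
  qed
  have le: "G v \<le> F w + d v w" if "v \<in> X" "w \<in> S" for v w
    unfolding G_def using bdd[OF that(1)] that(2) by (rule cINF_lower)
  have ge: "c \<le> G v" if "\<And>w. w \<in> S \<Longrightarrow> c \<le> F w + d v w" for c v
    unfolding G_def using S(2) that by (intro cINF_greatest) auto
  have *: "G v - d v v' \<le> G v'" if "v \<in> X" "v' \<in> X" for v v'
  proof (rule ge)
    fix w assume w: "w \<in> S"
    then show "G v - d v v' \<le> F w + d v' w"
      using le[OF that(1) w] tri[OF that, of w] S(1) by force
  qed
  have "\<bar>G v - G v'\<bar> \<le> d v v'" if "v \<in> X" "v' \<in> X" for v v'
    using *[OF that] *[OF that(2,1)] sym[OF that] by linarith
  then have "G \<in> Lip1 X d"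
    by (simp add: Lip1_def)
  moreover have "G s = F s" if s: "s \<in> S" for s
  proof (rule antisym)
    show "G s \<le> F s" using le[of s s] s S(1) refl by auto
    show "F s \<le> G s"
    proof (rule ge)
      fix w assume "w \<in> S"
      from Lip1D[OF F s this] show "F s \<le> F w + d s w" by linarith
    qed
  qed
  ultimately show ?thesis by blast
qed

text \<open>The norm is a supremum without absolute values, but \<open>- f\<close> is a test
  function whenever \<open>f\<close> is.\<close>

lemma abs_signed_integral_le_fm_norm_U:
  assumes q: "signed_measure (borel_on U) q"
    and f: "f \<in> Lip1 U dist" "\<And>x. x \<in> U \<Longrightarrow> \<bar>f x\<bar> \<le> 1"
  shows "\<bar>signed_integral (borel_on U) q f\<bar> \<le> fm_norm_U U q"
proof -
  let ?T = "{f \<in> Lip1 U dist. \<forall>x\<in>U. \<bar>f x\<bar> \<le> 1}"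
  have bdd: "bdd_above (signed_integral (borel_on U) q ` ?T)"
    using abs_signed_integral_le[OF q] by (intro bdd_aboveI2) (fastforce simp: abs_le_iff)
  have "signed_integral (borel_on U) q g \<le> fm_norm_U U q" if "g \<in> ?T" for g
    unfolding fm_norm_U_def fm_norm_def using bdd that by (intro cSUP_upper)
  from this[of f] this[of "\<lambda>x. - f x"] f Lip1_uminus[OF f(1)] show ?thesis
    by (auto simp: signed_integral_def)
qed

lemma fm_norm_U_least:
  assumes "\<And>f. f \<in> Lip1 U dist \<Longrightarrow> (\<And>x. x \<in> U \<Longrightarrow> \<bar>f x\<bar> \<le> 1) \<Longrightarrow> signed_integral (borel_on U) q f \<le> c"
  shows "fm_norm_U U q \<le> c"
proof -
  have "(\<lambda>_. 0) \<in> {f \<in> Lip1 U dist. \<forall>x\<in>U. \<bar>f x\<bar> \<le> 1}" by (simp add: Lip1_def)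
  then show ?thesis
    unfolding fm_norm_U_def fm_norm_def using assms by (intro cSUP_least) auto
qed

lemma fm_norm_U_nonneg: "signed_measure (borel_on U) q \<Longrightarrow> 0 \<le> fm_norm_U U q"
  using abs_signed_integral_le_fm_norm_U[of U q "\<lambda>_. 0"] by (simp add: Lip1_def)

lemma signed_integral_diff_Lip1:
  assumes "signed_measure (borel_on U) p" "signed_measure (borel_on U) q"
    and "f \<in> Lip1 U dist" "\<And>x. x \<in> U \<Longrightarrow> \<bar>f x\<bar> \<le> 1"
  shows "signed_integral (borel_on U) (\<lambda>A. p A - q A) f =
    signed_integral (borel_on U) p f - signed_integral (borel_on U) q f"
  using assms by (intro signed_integral_diff borel_measurable_Lip1) auto

section \<open>The Fortet--Mourier norm of differences as a pseudometric\<close>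

lemma fm_norm_U_commute:
  assumes "signed_measure (borel_on U) p" "signed_measure (borel_on U) q"
  shows "fm_norm_U U (\<lambda>A. p A - q A) = fm_norm_U U (\<lambda>A. q A - p A)"
proof -
  have "fm_norm_U U (\<lambda>A. p A - q A) \<le> fm_norm_U U (\<lambda>A. q A - p A)"
    if "signed_measure (borel_on U) p" "signed_measure (borel_on U) q" for p q
  proof (rule fm_norm_U_least)
    fix f assume f: "f \<in> Lip1 U dist" "\<And>x. x \<in> U \<Longrightarrow> \<bar>f x\<bar> \<le> 1"
    show "signed_integral (borel_on U) (\<lambda>A. p A - q A) f \<le> fm_norm_U U (\<lambda>A. q A - p A)"
      using abs_signed_integral_le_fm_norm_U[OF signed_measure_minus[OF that(2,1)] f]
        signed_integral_diff_Lip1[OF that f] signed_integral_diff_Lip1[OF that(2,1) f] by simp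
  qed
  from this[OF assms] this[OF assms(2,1)] show ?thesis by (rule antisym)
qed

lemma fm_norm_U_triangle:
  assumes "signed_measure (borel_on U) p" "signed_measure (borel_on U) q" "signed_measure (borel_on U) r"
  shows "fm_norm_U U (\<lambda>A. p A - r A) \<le> fm_norm_U U (\<lambda>A. p A - q A) + fm_norm_U U (\<lambda>A. q A - r A)"
proof (rule fm_norm_U_least)
  fix f assume f: "f \<in> Lip1 U dist" "\<And>x. x \<in> U \<Longrightarrow> \<bar>f x\<bar> \<le> 1"
  have "signed_integral (borel_on U) (\<lambda>A. p A - r A) f =
    signed_integral (borel_on U) (\<lambda>A. p A - q A) f + signed_integral (borel_on U) (\<lambda>A. q A - r A) f"
    using assms f by (simp add: signed_integral_diff_Lip1)
  then show "signed_integral (borel_on U) (\<lambda>A. p A - r A) f \<le>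
      fm_norm_U U (\<lambda>A. p A - q A) + fm_norm_U U (\<lambda>A. q A - r A)"
    using abs_signed_integral_le_fm_norm_U[OF signed_measure_minus[OF assms(1,2)] f]
      abs_signed_integral_le_fm_norm_U[OF signed_measure_minus[OF assms(2,3)] f] by simp
qed

lemma fm_norm_U_self:
  assumes "signed_measure (borel_on U) q"
  shows "fm_norm_U U (\<lambda>A. q A - q A) = 0"
proof (rule antisym)
  show "fm_norm_U U (\<lambda>A. q A - q A) \<le> 0"
    by (rule fm_norm_U_least) (subst signed_integral_diff_Lip1[OF assms assms], auto)
  show "0 \<le> fm_norm_U U (\<lambda>A. q A - q A)"
    by (rule fm_norm_U_nonneg[OF signed_measure_minus[OF assms assms]])
qed

lemma (in prob_space) abs_integral_le:
  fixes f :: "'a \<Rightarrow> real"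
  assumes "f \<in> borel_measurable M" "\<And>x. x \<in> space M \<Longrightarrow> \<bar>f x\<bar> \<le> C"
  shows "\<bar>\<integral>x. f x \<partial>M\<bar> \<le> C"
proof -
  have int: "integrable M f" using assms by (rule integrable_bounded_on_space)
  have "\<bar>\<integral>x. f x \<partial>M\<bar> \<le> (\<integral>x. \<bar>f x\<bar> \<partial>M)" by (rule integral_abs_bound)
  also have "\<dots> \<le> C" using int assms(2) by (intro integral_le_const) auto
  finally show ?thesis .
qed

text \<open>Each of the two probability measures contributes at most 1. The resulting finite
  diameter of \<open>prob_on U\<close> lets Lipschitz functions on pairs be dominated by the norm of
  the first component plus a constant.\<close>

lemma fm_norm_U_prob_on_le:
  assumes p: "p \<in> prob_on U" and q: "q \<in> prob_on U"
  shows "fm_norm_U U (\<lambda>A. p A - q A) \<le> 2"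
proof (rule fm_norm_U_least)
  fix f assume f: "f \<in> Lip1 U dist" "\<And>x. x \<in> U \<Longrightarrow> \<bar>f x\<bar> \<le> 1"
  have "\<bar>signed_integral (borel_on U) r f\<bar> \<le> 1" if "r \<in> prob_on U" for r
    unfolding signed_integral_prob_on[OF that]
    using f borel_measurable_Lip1[OF f(1)]
    by (intro prob_space.abs_integral_le[OF prob_onD(1)[OF that]]) auto
  from this[OF p] this[OF q]
  show "signed_integral (borel_on U) (\<lambda>A. p A - q A) f \<le> 2"
    using signed_integral_diff_Lip1[OF prob_onD(3)[OF p] prob_onD(3)[OF q] f] by linarith
qed


section \<open>The metric on \<open>V\<close>\<close>

lemma signed_radonD: "q \<in> signed_radon U \<Longrightarrow> signed_measure (borel_on U) q"
  by (simp add: signed_radon_def)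

lemma V_dist_commute: "v \<in> V_space U \<Longrightarrow> w \<in> V_space U \<Longrightarrow> V_dist U v w = V_dist U w v"
  by (auto simp: V_dist_def V_norm_def V_space_def norm_minus_commute
      intro!: fm_norm_U_commute dest!: signed_radonD)

lemma V_dist_self: "v \<in> V_space U \<Longrightarrow> V_dist U v v = 0"
  by (auto simp: V_dist_def V_norm_def V_space_def dest!: signed_radonD fm_norm_U_self)

lemma V_dist_triangle:
  assumes "u \<in> V_space U" "v \<in> V_space U" "w \<in> V_space U"
  shows "V_dist U u w \<le> V_dist U u v + V_dist U v w"
  using fm_norm_U_triangle[of U "snd u" "snd v" "snd w"] assms norm_diff_triangle_ineq[of "fst u" "fst v" "fst v" "fst w"]
  by (auto simp: V_dist_def V_norm_def V_space_def dest!: signed_radonD)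


section \<open>The averaging map\<close>

text \<open>For \<open>v = (x, q)\<close> this is the product of the Dirac measure at
  \<open>x\<close> with \<open>q\<close>; \<open>pos_variation\<close> recovers the measure from the
  set function \<open>q\<close>.\<close>

definition fibre_measure ::
    "'b::metric_space set \<Rightarrow> 'a::topological_space \<times> ('b set \<Rightarrow> real) \<Rightarrow> ('a \<times> 'b) measure" where
  "fibre_measure U v =
     distr (pos_variation (borel_on U) (snd v)) (borel_on (UNIV \<times> U)) (Pair (fst v))"

lemma measurable_Pair_borel_on [measurable]:
  "Pair x \<in> measurable (borel_on U) (borel_on (UNIV \<times> U))"
  unfolding borel_on_def
  by (intro measurable_restrict_space2 borel_measurable_continuous_on_restrict continuous_intros)
    (auto simp: space_restrict_space)

lemma prob_space_fibre_measure: "snd v \<in> prob_on U \<Longrightarrow> prob_space (fibre_measure U v)"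
  unfolding fibre_measure_def by (intro prob_space.prob_space_distr prob_onD(1)) simp_all

lemma sets_fibre_measure [simp]: "sets (fibre_measure U v) = sets (borel_on (UNIV \<times> U))"
  and space_fibre_measure [simp]: "space (fibre_measure U v) = UNIV \<times> U"
  by (simp_all add: fibre_measure_def)

lemma measurable_fibre_measure_eq [simp]:
  "measurable (fibre_measure U v) N = measurable (borel_on (UNIV \<times> U)) N"
  by (rule measurable_cong_sets) simp_all

text \<open>The right-hand side is the integrand in \<open>average\<close>, which is what makes the
  average a mixture of the fibre measures.\<close>

lemma emeasure_fibre_measure:
  assumes q: "q \<in> prob_on U" and A: "A \<in> sets (borel_on (UNIV \<times> U))"
  shows "emeasure (fibre_measure U (x, q)) A = ennreal (q {u. (x, u) \<in> A})"
proof -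
  interpret prob_space "pos_variation (borel_on U) q" by (rule prob_onD(1)[OF q])
  have "Pair x -` A \<inter> U = {u. (x, u) \<in> A}"
    using sets.sets_into_space[OF A] by auto
  then show ?thesis
    using A by (simp add: fibre_measure_def emeasure_distr emeasure_eq_measure prob_onD(2)[OF q])
qed

lemma integral_fibre_measure:
  fixes f :: "_ \<Rightarrow> real"
  assumes "f \<in> borel_measurable (borel_on (UNIV \<times> U))"
  shows "(\<integral>p. f p \<partial>fibre_measure U (x, q)) = (\<integral>u. f (x, u) \<partial>pos_variation (borel_on U) q)"
  unfolding fibre_measure_def using assms by (simp add: integral_distr)

text \<open>Half of the equivalence of the two product norms: functions that are 1-Lipschitz for the
  library metric are 1-Lipschitz for the sum norm. The converse bound \<open>sum_norm_le\<close>
  makes test functions continuous.\<close>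

lemma dist_le_sum_dist: "dist p p' \<le> sum_dist p p'"
  using norm_Pair_le[of "fst (p - p')" "snd (p - p')"]
  by (simp add: dist_norm sum_dist_def sum_norm_def del: fst_diff snd_diff)

lemma sum_norm_le: "sum_norm p \<le> 2 * norm p"
  using norm_fst_le[of "fst p" "snd p"] norm_snd_le[of "snd p" "fst p"] by (simp add: sum_norm_def)

lemma continuous_on_sum_norm [continuous_intros]: "continuous_on S sum_norm"
  unfolding sum_norm_def by (intro continuous_intros)

lemma borel_measurable_Lip1_sum_dist:
  assumes "f \<in> Lip1 UNIV sum_dist"
  shows "f \<in> borel_measurable (borel_on E)"
proof -
  have "\<bar>f y - f x\<bar> < e" if "dist y x < e / 2" for x y e
    using Lip1D[OF assms, of y x] sum_norm_le[of "y - x"] that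
    by (simp add: sum_dist_def dist_norm)
  then have "continuous_on E f"
    unfolding continuous_on_iff dist_real_def by (meson half_gt_zero)
  then show ?thesis
    unfolding borel_on_def by (rule borel_measurable_continuous_on_restrict)
qed

text \<open>Only on \<open>\<real>\<^sup>n \<times> \<P>(U)\<close>: on \<open>V\<close> the constant would involve the total variation of \<open>q\<close>.\<close>

lemma Lip1_integral_fibre_measure:
  assumes f: "f \<in> Lip1 UNIV sum_dist" and bound: "\<And>p. \<bar>f p\<bar> \<le> 1"
  shows "(\<lambda>v. \<integral>p. f p \<partial>fibre_measure U v) \<in> Lip1 (UNIV \<times> prob_on U) (V_dist U)"
proof -
  have "\<bar>(\<integral>p. f p \<partial>fibre_measure U (x, p)) - (\<integral>p. f p \<partial>fibre_measure U (y, q))\<bar> \<le>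
      V_dist U (x, p) (y, q)" if p: "p \<in> prob_on U" and q: "q \<in> prob_on U" for x y p q
  proof -
    have fx: "(\<lambda>u. f (x, u)) \<in> Lip1 U dist" for x
      using Lip1D[OF f, of "(x, _)" "(x, _)"] by (simp add: Lip1_def sum_dist_def sum_norm_def dist_norm)
    have int: "integrable (pos_variation (borel_on U) p) (\<lambda>u. f (x, u))" for x
      using bound borel_measurable_Lip1[OF fx] prob_onD(1)[OF p]
      by (intro finite_measure.integrable_bounded_on_space[where C = 1])
        (auto simp: prob_space.finite_measure)
    \<comment> \<open>The path goes from \<open>(x, p)\<close> through \<open>(y, p)\<close> to
      \<open>(y, q)\<close>. The first leg costs \<open>norm (x - y)\<close> because
      \<open>p\<close> has mass 1; on the second, \<open>\<lambda>u. f (y, u)\<close> is a test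
      function for the Fortet--Mourier norm on \<open>U\<close>.\<close>
    have "\<bar>(\<integral>u. f (x, u) \<partial>pos_variation (borel_on U) p) - (\<integral>u. f (y, u) \<partial>pos_variation (borel_on U) p)\<bar>
        = \<bar>\<integral>u. f (x, u) - f (y, u) \<partial>pos_variation (borel_on U) p\<bar>"
      by (simp add: Bochner_Integration.integral_diff[OF int int])
    also have "\<dots> \<le> norm (x - y)"
    proof (rule prob_space.abs_integral_le[OF prob_onD(1)[OF p]])
      show "(\<lambda>u. f (x, u) - f (y, u)) \<in> borel_measurable (pos_variation (borel_on U) p)"
        using borel_measurable_Lip1[OF fx] by simp
      show "\<bar>f (x, u) - f (y, u)\<bar> \<le> norm (x - y)" for u
        using Lip1D[OF f, of "(x, u)" "(y, u)"] by (simp add: sum_dist_def sum_norm_def)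
    qed
    finally have 1: "\<bar>(\<integral>u. f (x, u) \<partial>pos_variation (borel_on U) p) -
      (\<integral>u. f (y, u) \<partial>pos_variation (borel_on U) p)\<bar> \<le> norm (x - y)" .
    have "\<bar>signed_integral (borel_on U) (\<lambda>A. p A - q A) (\<lambda>u. f (y, u))\<bar> \<le> fm_norm_U U (\<lambda>A. p A - q A)"
      using bound p q
      by (intro abs_signed_integral_le_fm_norm_U signed_measure_minus prob_onD(3) fx) auto
    then have 2: "\<bar>(\<integral>u. f (y, u) \<partial>pos_variation (borel_on U) p) -
      (\<integral>u. f (y, u) \<partial>pos_variation (borel_on U) q)\<bar> \<le> fm_norm_U U (\<lambda>A. p A - q A)"
      using signed_integral_diff_Lip1[OF prob_onD(3)[OF p] prob_onD(3)[OF q] fx bound, of y]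
      by (simp add: signed_integral_prob_on p q)
    from 1 2 show ?thesis
      unfolding integral_fibre_measure[OF borel_measurable_Lip1_sum_dist[OF f]]
      by (simp add: V_dist_def V_norm_def)
  qed
  then show ?thesis by (auto simp: Lip1_def)
qed

section \<open>Measurability of the fibre kernel\<close>

lemma space_metric_borel [simp]: "space (metric_borel X d) = X"
  unfolding metric_borel_def by (rule space_measure_of) auto

lemma sets_borel_on_closed_eq_sigma_sets:
  assumes E: "closed E"
  shows "sets (borel_on E) = sigma_sets E {A. closed A \<and> A \<subseteq> E}"
proof -
  have "sets (borel_on E) = (\<inter>) E ` sigma_sets UNIV (Collect closed)"
    by (simp add: borel_on_def sets_restrict_space borel_eq_closed)
  also have "\<dots> = sigma_sets E ((\<inter>) E ` Collect closed)"
    using E by (intro sigma_sets_Int) auto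
  also have "(\<inter>) E ` Collect closed = {A. closed A \<and> A \<subseteq> E}"
    using E by (auto simp: image_iff)
  finally show ?thesis .
qed

text \<open>So far only integrals of bounded Lipschitz functions are known to depend measurably on
  \<open>v\<close>. Closed sets are an intersection-stable generator, and their indicators are
  limits of multiples of such functions, so dominated convergence suffices.\<close>

lemma measurable_fibre_measure:
  fixes U :: "'b::banach set"
  assumes U: "closed U"
  shows "fibre_measure U \<in> metric_borel (UNIV \<times> prob_on U) (V_dist U) \<rightarrow>\<^sub>M
    prob_algebra (borel_on ((UNIV :: (real ^ 'n) set) \<times> U))"
proof (rule measurable_prob_algebra_generated)
  let ?E = "(UNIV :: (real ^ 'n) set) \<times> U"
  have E: "closed ?E" using U by (intro closed_Times) auto
  show "sets (borel_on ?E) = sigma_sets ?E {A. closed A \<and> A \<subseteq> ?E}"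
    by (rule sets_borel_on_closed_eq_sigma_sets[OF E])
  show "Int_stable {A. closed A \<and> A \<subseteq> ?E}"
    by (auto simp: Int_stable_def)
  fix A :: "((real ^ 'n) \<times> 'b) set" assume "A \<in> {A. closed A \<and> A \<subseteq> ?E}"
  then have A: "closed A" "A \<subseteq> ?E" by auto
  let ?X = "metric_borel ((UNIV :: (real ^ 'n) set) \<times> prob_on U) (V_dist U)"
  have A_sets: "A \<in> sets (borel_on ?E)"
    using A by (simp add: sets_borel_on_closed[OF E])
  show "(\<lambda>v. emeasure (fibre_measure U v) A) \<in> borel_measurable ?X"
  \<comment> \<open>By convention \<open>infdist p {} = 0\<close>, so for empty \<open>A\<close> the
    approximating functions below would be constantly 1.\<close>
  proof (cases "A = {}")
    case False
    \<comment> \<open>Truncation at height \<open>1 / real (Suc k)\<close> keeps \<open>g k\<close>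
      1-Lipschitz and bounded by 1. Multiplied by \<open>real (Suc k)\<close> it is 1 on
      \<open>A\<close> and vanishes at distance \<open>1 / real (Suc k)\<close> and beyond; the
      factor stays outside \<open>g k\<close> to preserve the Lipschitz constant.\<close>
    define g where "g k p = max 0 (1 / real (Suc k) - infdist p A)" for k p
    have g: "g k \<in> Lip1 UNIV sum_dist" for k
    proof -
      have "\<bar>g k p - g k p'\<bar> \<le> sum_dist p p'" for p p'
        using infdist_triangle_abs[of p A p'] dist_le_sum_dist[of p p'] by (auto simp: g_def)
      then show ?thesis by (simp add: Lip1_def)
    qed
    have g_bound: "0 \<le> g k p" "g k p \<le> 1 / real (Suc k)" for k p
      using infdist_nonneg[of p A] by (auto simp: g_def)
    have g_bound1: "\<bar>g k p\<bar> \<le> 1" for k p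
      using g_bound[of k p] order.trans[of "g k p" "1 / real (Suc k)" 1] by simp
    have lim: "(\<lambda>k. real (Suc k) * g k p) \<longlonglongrightarrow> indicator A p" for p
    proof (cases "p \<in> A")
      case False
      then have "infdist p A > 0"
        using infdist_pos_not_in_closed A(1) \<open>A \<noteq> {}\<close> by auto
      then have "eventually (\<lambda>k. 1 / real (Suc k) < infdist p A) sequentially"
        using LIMSEQ_inverse_real_of_nat by (auto dest: order_tendstoD(2) simp: inverse_eq_divide)
      then have "eventually (\<lambda>k. real (Suc k) * g k p = indicator A p) sequentially"
        using False by (auto simp: g_def max_def elim!: eventually_mono)
      then show ?thesis by (rule tendsto_eventually)
    qed (simp add: g_def)
    have meas: "g k \<in> borel_measurable (borel_on ?E)" for k
      by (rule borel_measurable_Lip1_sum_dist[OF g])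
    have "(\<lambda>v. measure (fibre_measure U v) A) \<in> borel_measurable ?X"
    proof (rule borel_measurable_LIMSEQ_real)
      fix v assume "v \<in> space ?X"
      then interpret prob_space "fibre_measure U v"
        by (intro prob_space_fibre_measure) auto
      have "(\<lambda>k. \<integral>p. real (Suc k) * g k p \<partial>fibre_measure U v) \<longlonglongrightarrow>
          (\<integral>p. indicator A p \<partial>fibre_measure U v)"
      proof (rule integral_dominated_convergence[where w = "\<lambda>_. 1"])
        show "AE p in fibre_measure U v. norm (real (Suc k) * g k p) \<le> 1" for k
          using g_bound[of k] by (auto simp: abs_mult field_simps)
        show "(\<lambda>p. real (Suc k) * g k p) \<in> borel_measurable (fibre_measure U v)" for k
          unfolding measurable_fibre_measure_eq
          by (intro borel_measurable_times borel_measurable_const meas)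
      qed (use A_sets lim in auto)
      then show "(\<lambda>k. \<integral>p. real (Suc k) * g k p \<partial>fibre_measure U v) \<longlonglongrightarrow> measure (fibre_measure U v) A"
        using A(2) by (simp add: Int_absorb2)
    next
      show "(\<lambda>v. \<integral>p. real (Suc k) * g k p \<partial>fibre_measure U v) \<in> borel_measurable ?X" for k
        using borel_measurable_Lip1_metric_borel[OF Lip1_integral_fibre_measure[of "g k" U, OF g g_bound1]]
        by simp
    qed
    moreover have "emeasure (fibre_measure U v) A = ennreal (measure (fibre_measure U v) A)"
      if "v \<in> space ?X" for v
      using that by (intro finite_measure.emeasure_eq_measure prob_space.finite_measure
          prob_space_fibre_measure) auto
    ultimately show ?thesis
      by (subst measurable_cong) (assumption, simp)
  qed simp
qed (auto intro: prob_space_fibre_measure)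

section \<open>The average as a mixture of fibre measures\<close>

lemma P2_relaxedD:
  assumes "\<xi> \<in> P2_relaxed U"
  shows "prob_space \<xi>" "sets \<xi> = sets (metric_borel (UNIV \<times> prob_on U) (V_dist U))"
    "space \<xi> = UNIV \<times> prob_on U" "integrable \<xi> (\<lambda>v. (V_norm U v)\<^sup>2)"
    "measurable \<xi> N = measurable (metric_borel (UNIV \<times> prob_on U) (V_dist U)) N"
proof -
  show sets: "sets \<xi> = sets (metric_borel (UNIV \<times> prob_on U) (V_dist U))"
    using assms by (simp add: P2_relaxed_def)
  show "space \<xi> = UNIV \<times> prob_on U"
    using sets_eq_imp_space_eq[OF sets] by simp
qed (use assms in \<open>auto simp: P2_relaxed_def intro!: measurable_cong_sets\<close>)

text \<open>The bind is already known to be a measure and agrees on Borel sets with the set function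
  in \<open>average\<close>; thus \<open>measure_of\<close> returns the intended object.\<close>

lemma average_eq_bind:
  fixes \<xi> :: "((real ^ 'n) \<times> ('b::banach set \<Rightarrow> real)) measure"
  assumes U: "closed U" and \<xi>: "\<xi> \<in> P2_relaxed U"
  shows "average U \<xi> = \<xi> \<bind> fibre_measure U"
    and "prob_space (average U \<xi>)" and "sets (average U \<xi>) = sets (borel_on (UNIV \<times> U))"
proof -
  interpret prob_space \<xi> by (rule P2_relaxedD(1)[OF \<xi>])
  let ?E = "borel_on ((UNIV :: (real ^ 'n) set) \<times> U)"
  have \<xi>_alg: "\<xi> \<in> space (prob_algebra \<xi>)"
    by (simp add: space_prob_algebra prob_space_axioms)
  have fibre: "fibre_measure U \<in> \<xi> \<rightarrow>\<^sub>M prob_algebra ?E"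
    unfolding P2_relaxedD(5)[OF \<xi>] by (rule measurable_fibre_measure[OF U])
  have sets: "sets (\<xi> \<bind> fibre_measure U) = sets ?E"
    by (rule sets_bind'[OF \<xi>_alg fibre])
  have "average U \<xi> = measure_of (UNIV \<times> U) (sets ?E) (emeasure (\<xi> \<bind> fibre_measure U))"
    unfolding average_def
  proof (rule measure_of_eq)
    show "sets ?E \<subseteq> Pow (UNIV \<times> U)" using sets.sets_into_space[of _ ?E] by auto
    fix A assume "A \<in> sigma_sets (UNIV \<times> U) (sets ?E)"
    then have A: "A \<in> sets ?E" using sets.sigma_sets_eq[of ?E] by simp
    show "(\<integral>\<^sup>+(x, q). ennreal (q {u. (x, u) \<in> A}) \<partial>\<xi>) = emeasure (\<xi> \<bind> fibre_measure U) A"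
      unfolding emeasure_bind_prob_algebra[OF \<xi>_alg fibre A]
      by (intro nn_integral_cong) (auto simp: P2_relaxedD(3)[OF \<xi>] emeasure_fibre_measure A)
  qed
  also have "\<dots> = \<xi> \<bind> fibre_measure U"
    using measure_of_of_measure[of "\<xi> \<bind> fibre_measure U"] sets_eq_imp_space_eq[OF sets]
    by (simp add: sets)
  finally show *: "average U \<xi> = \<xi> \<bind> fibre_measure U" .
  show "prob_space (average U \<xi>)" "sets (average U \<xi>) = sets ?E"
    unfolding * by (rule prob_space_bind'[OF \<xi>_alg fibre], rule sets)
qed

lemma integral_average:
  fixes f :: "_ \<Rightarrow> real"
  assumes U: "closed U" and \<xi>: "\<xi> \<in> P2_relaxed U"
    and f: "f \<in> borel_measurable (borel_on (UNIV \<times> U))" "\<And>p. \<bar>f p\<bar> \<le> C"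
  shows "(\<integral>p. f p \<partial>average U \<xi>) = (\<integral>v. \<integral>p. f p \<partial>fibre_measure U v \<partial>\<xi>)"
  unfolding average_eq_bind(1)[OF U \<xi>]
proof (rule integral_bind[OF f, where B' = 1])
  show "fibre_measure U \<in> \<xi> \<rightarrow>\<^sub>M subprob_algebra (borel_on (UNIV \<times> U))"
    unfolding P2_relaxedD(5)[OF \<xi>] by (intro measurable_prob_algebraD measurable_fibre_measure U)
  show "finite_measure \<xi>"
    by (rule prob_space.finite_measure[OF P2_relaxedD(1)[OF \<xi>]])
  show "AE v in \<xi>. emeasure (fibre_measure U v) (space (fibre_measure U v)) \<le> ennreal 1"
    by (intro AE_I2) (auto simp: P2_relaxedD(3)[OF \<xi>]
        prob_space.emeasure_space_1[OF prob_space_fibre_measure] simp del: space_fibre_measure)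
qed

section \<open>Moments of \<open>\<xi>\<close> and of its average\<close>

lemma P2_relaxed_integrable_norm:
  fixes \<xi> :: "((real ^ 'n) \<times> ('b::banach set \<Rightarrow> real)) measure"
  assumes \<xi>: "\<xi> \<in> P2_relaxed U"
  shows "integrable \<xi> (\<lambda>v. norm (fst v))" "integrable \<xi> (\<lambda>v. (norm (fst v))\<^sup>2)"
proof -
  interpret prob_space \<xi> by (rule P2_relaxedD(1)[OF \<xi>])
  \<comment> \<open>Measurability cannot be read off a product sigma-algebra here; it follows from
    the Lipschitz property for \<open>V_dist\<close>.\<close>
  have "(\<lambda>v. norm (fst v)) \<in> Lip1 (UNIV \<times> prob_on U) (V_dist U)"
  proof -
    have "\<bar>norm x - norm y\<bar> \<le> V_dist U (x, p) (y, q)" if "p \<in> prob_on U" "q \<in> prob_on U" for x y p q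
      using norm_triangle_ineq3[of x y]
        fm_norm_U_nonneg[OF signed_measure_minus[OF prob_onD(3)[OF that(1)] prob_onD(3)[OF that(2)]]]
      by (simp add: V_dist_def V_norm_def)
    then show ?thesis by (auto simp: Lip1_def)
  qed
  then have meas: "(\<lambda>v. norm (fst v)) \<in> borel_measurable \<xi>"
    unfolding P2_relaxedD(5)[OF \<xi>] by (rule borel_measurable_Lip1_metric_borel)
  have le: "norm (fst v) \<le> V_norm U v" if "v \<in> space \<xi>" for v
    using that fm_norm_U_nonneg[OF prob_onD(3)] by (auto simp: V_norm_def P2_relaxedD(3)[OF \<xi>])
  show sq: "integrable \<xi> (\<lambda>v. (norm (fst v))\<^sup>2)"
    using le meas
    by (intro Bochner_Integration.integrable_bound[OF P2_relaxedD(4)[OF \<xi>]] AE_I2)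
      (auto intro!: power_mono)
  have "x \<le> 1 + x\<^sup>2" for x :: real
    using zero_le_power2[of "x - 1/2"] by (simp add: power2_eq_square algebra_simps)
  then show "integrable \<xi> (\<lambda>v. norm (fst v))"
    using meas
    by (intro Bochner_Integration.integrable_bound[OF Bochner_Integration.integrable_add[OF integrable_const[of 1] sq]] AE_I2)
      auto
qed

text \<open>Compactness bounds \<open>norm u\<close> on \<open>U\<close> by some \<open>C\<close>,
  and (a + b)^2 is at most 2 a^2 + 2 b^2, so the second moment of each fibre measure is controlled
  by the norm of \<open>x\<close>, which is square integrable.\<close>

lemma average_in_P2_states:
  fixes \<xi> :: "((real ^ 'n) \<times> ('b::banach set \<Rightarrow> real)) measure"
  assumes U: "compact U" and \<xi>: "\<xi> \<in> P2_relaxed U"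
  shows "average U \<xi> \<in> P2_states U"
proof -
  note clU = compact_imp_closed[OF U]
  interpret prob_space \<xi> by (rule P2_relaxedD(1)[OF \<xi>])
  obtain C where C: "\<And>u. u \<in> U \<Longrightarrow> norm u \<le> C"
    using compact_imp_bounded[OF U] by (auto simp: bounded_iff)
  let ?E = "borel_on ((UNIV :: (real ^ 'n) set) \<times> U)"
  have meas: "(\<lambda>p. (sum_norm p)\<^sup>2) \<in> borel_measurable ?E"
    unfolding borel_on_def
    by (intro borel_measurable_continuous_on_restrict continuous_intros)
  have fibre: "fibre_measure U \<in> \<xi> \<rightarrow>\<^sub>M subprob_algebra ?E"
    unfolding P2_relaxedD(5)[OF \<xi>] by (intro measurable_prob_algebraD measurable_fibre_measure clU)
  have "(\<integral>\<^sup>+p. ennreal ((sum_norm p)\<^sup>2) \<partial>average U \<xi>) =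
    (\<integral>\<^sup>+v. \<integral>\<^sup>+p. ennreal ((sum_norm p)\<^sup>2) \<partial>fibre_measure U v \<partial>\<xi>)"
    unfolding average_eq_bind(1)[OF clU \<xi>] using meas by (intro nn_integral_bind[OF _ fibre]) simp
  also have "\<dots> \<le> (\<integral>\<^sup>+v. ennreal (2 * (norm (fst v))\<^sup>2 + 2 * C\<^sup>2) \<partial>\<xi>)"
  proof (rule nn_integral_mono)
    fix v assume v: "v \<in> space \<xi>"
    then interpret q: prob_space "pos_variation (borel_on U) (snd v)"
      by (intro prob_onD(1)) (auto simp: P2_relaxedD(3)[OF \<xi>])
    have "(\<integral>\<^sup>+p. ennreal ((sum_norm p)\<^sup>2) \<partial>fibre_measure U v) =
      (\<integral>\<^sup>+u. ennreal ((sum_norm (fst v, u))\<^sup>2) \<partial>pos_variation (borel_on U) (snd v))"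
      unfolding fibre_measure_def using meas by (subst nn_integral_distr) auto
    also have "\<dots> \<le> (\<integral>\<^sup>+u. ennreal (2 * (norm (fst v))\<^sup>2 + 2 * C\<^sup>2) \<partial>pos_variation (borel_on U) (snd v))"
    proof (intro nn_integral_mono ennreal_leI)
      fix u assume "u \<in> space (pos_variation (borel_on U) (snd v))"
      then have "(norm u)\<^sup>2 \<le> C\<^sup>2" using C by (auto intro!: power_mono)
      moreover have "(norm (fst v) + norm u)\<^sup>2 \<le> 2 * (norm (fst v))\<^sup>2 + 2 * (norm u)\<^sup>2"
        using zero_le_power2[of "norm (fst v) - norm u"] by (simp add: power2_eq_square algebra_simps)
      ultimately show "(sum_norm (fst v, u))\<^sup>2 \<le> 2 * (norm (fst v))\<^sup>2 + 2 * C\<^sup>2"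
        by (simp add: sum_norm_def)
    qed
    also have "\<dots> = ennreal (2 * (norm (fst v))\<^sup>2 + 2 * C\<^sup>2)"
      using q.emeasure_space_1 by simp
    finally show "(\<integral>\<^sup>+p. ennreal ((sum_norm p)\<^sup>2) \<partial>fibre_measure U v) \<le>
      ennreal (2 * (norm (fst v))\<^sup>2 + 2 * C\<^sup>2)" .
  qed
  also have "\<dots> < \<infinity>"
    using P2_relaxed_integrable_norm(2)[OF \<xi>]
    by (subst nn_integral_eq_integral) auto
  finally have "integrable (average U \<xi>) (\<lambda>p. (sum_norm p)\<^sup>2)"
    using meas measurable_cong_sets[OF average_eq_bind(3)[OF clU \<xi>] refl, of borel]
    by (intro integrableI_bounded) auto
  then show ?thesis
    using average_eq_bind[OF clU \<xi>] by (simp add: P2_states_def)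
qed


text \<open>There are unboundedly many test functions, since constants may be added, but a constant
  cancels in the difference of two probability integrals. Each integral is therefore compared with
  the same value \<open>f (x0, q0)\<close>.\<close>

lemma bdd_above_KR:
  fixes \<xi>1 \<xi>2 :: "((real ^ 'n) \<times> ('b::banach set \<Rightarrow> real)) measure"
  assumes U: "compact U" and \<xi>: "\<xi>1 \<in> P2_relaxed U" "\<xi>2 \<in> P2_relaxed U"
  shows "bdd_above ((\<lambda>f. (\<integral>v. f v \<partial>\<xi>1) - (\<integral>v. f v \<partial>\<xi>2)) ` Lip1 (V_space U) (V_dist U))"
proof -
  interpret \<xi>1: prob_space \<xi>1 by (rule P2_relaxedD(1)[OF \<xi>(1)])
  obtain x0 :: "real ^ 'n" and q0 where q0: "(x0, q0) \<in> UNIV \<times> prob_on U"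
    using \<xi>1.not_empty P2_relaxedD(3)[OF \<xi>(1)] by auto
  have *: "\<bar>(\<integral>v. f v \<partial>\<xi>) - f (x0, q0)\<bar> \<le> (\<integral>v. norm (fst v) \<partial>\<xi>) + norm x0 + 2"
    if f: "f \<in> Lip1 (V_space U) (V_dist U)" and \<xi>: "\<xi> \<in> P2_relaxed U"
    for f and \<xi> :: "((real ^ 'n) \<times> ('b set \<Rightarrow> real)) measure"
  proof -
    interpret prob_space \<xi> by (rule P2_relaxedD(1)[OF \<xi>])
    have f': "f \<in> Lip1 (UNIV \<times> prob_on U) (V_dist U)"
      using Lip1D[OF f] prob_on_subset_signed_radon[OF U]
      by (auto simp: Lip1_def V_space_def subset_iff)
    have meas: "f \<in> borel_measurable \<xi>"
      unfolding P2_relaxedD(5)[OF \<xi>] by (rule borel_measurable_Lip1_metric_borel[OF f'])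
    have bound: "\<bar>f v - f (x0, q0)\<bar> \<le> norm (fst v) + norm x0 + 2" if "v \<in> space \<xi>" for v
    proof -
      have v: "v \<in> UNIV \<times> prob_on U" using that P2_relaxedD(3)[OF \<xi>] by simp
      \<comment> \<open>The 2 is the diameter bound for \<open>prob_on U\<close>; the rest is the
        triangle inequality for the first component.\<close>
      have "V_dist U v (x0, q0) \<le> norm (fst v) + norm x0 + 2"
        using fm_norm_U_prob_on_le[of "snd v" U q0] v q0 norm_triangle_ineq4[of "fst v" x0]
        by (auto simp: V_dist_def V_norm_def)
      with Lip1D[OF f' v q0] show ?thesis by linarith
    qed
    have int_bound: "integrable \<xi> (\<lambda>v. norm (fst v) + norm x0 + 2)"
      using P2_relaxed_integrable_norm(1)[OF \<xi>] by simp
    have int: "integrable \<xi> (\<lambda>v. f v - f (x0, q0))"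
      using bound meas by (intro Bochner_Integration.integrable_bound[OF int_bound] AE_I2) force+
    from Bochner_Integration.integrable_add[OF this integrable_const[of "f (x0, q0)"]]
    have "integrable \<xi> f" by simp
    then have "(\<integral>v. f v \<partial>\<xi>) - f (x0, q0) = (\<integral>v. f v - f (x0, q0) \<partial>\<xi>)"
      by (simp add: prob_space)
    also have "\<bar>\<dots>\<bar> \<le> (\<integral>v. \<bar>f v - f (x0, q0)\<bar> \<partial>\<xi>)"
      by (rule integral_abs_bound)
    also have "\<dots> \<le> (\<integral>v. norm (fst v) + norm x0 + 2 \<partial>\<xi>)"
      using int int_bound bound by (intro integral_mono) auto
    also have "\<dots> = (\<integral>v. norm (fst v) \<partial>\<xi>) + norm x0 + 2"
      using P2_relaxed_integrable_norm(1)[OF \<xi>] by (simp add: prob_space)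
    finally show ?thesis .
  qed
  show ?thesis
  proof (rule bdd_aboveI2)
    fix f :: "(real ^ 'n) \<times> ('b set \<Rightarrow> real) \<Rightarrow> real"
    assume f: "f \<in> Lip1 (V_space U) (V_dist U)"
    show "(\<integral>v. f v \<partial>\<xi>1) - (\<integral>v. f v \<partial>\<xi>2) \<le>
      ((\<integral>v. norm (fst v) \<partial>\<xi>1) + norm x0 + 2) + ((\<integral>v. norm (fst v) \<partial>\<xi>2) + norm x0 + 2)"
      using *[OF f \<xi>(1)] *[OF f \<xi>(2)] by linarith
  qed
qed

lemma fm_dist_K_average_le_KR_dist:
  fixes \<xi>1 \<xi>2 :: "((real ^ 'n) \<times> ('b::banach set \<Rightarrow> real)) measure"
  assumes U: "compact U" and \<xi>: "\<xi>1 \<in> P2_relaxed U" "\<xi>2 \<in> P2_relaxed U"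
  shows "fm_dist_K U (average U \<xi>1) (average U \<xi>2) \<le> KR_dist U \<xi>1 \<xi>2"
  unfolding fm_dist_K_def fm_norm_K_def fm_norm_def
proof (rule cSUP_least)
  have "(\<lambda>_. 0) \<in> {f \<in> Lip1 UNIV sum_dist. \<forall>x\<in>UNIV. \<bar>f x\<bar> \<le> 1}"
    by (simp add: Lip1_def sum_dist_def sum_norm_def)
  then show "{f \<in> Lip1 UNIV sum_dist. \<forall>x\<in>UNIV. \<bar>f x\<bar> \<le> 1} \<noteq> {}" by blast
next
  note clU = compact_imp_closed[OF U]
  let ?E = "borel_on ((UNIV :: (real ^ 'n) set) \<times> U)"
  fix f :: "(real ^ 'n) \<times> 'b \<Rightarrow> real"
  assume "f \<in> {f \<in> Lip1 UNIV sum_dist. \<forall>x\<in>UNIV. \<bar>f x\<bar> \<le> 1}"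
  then have f: "f \<in> Lip1 UNIV sum_dist" and bound: "\<And>p. \<bar>f p\<bar> \<le> 1" by auto
  note meas = borel_measurable_Lip1_sum_dist[OF f]
  interpret \<xi>1: prob_space \<xi>1 by (rule P2_relaxedD(1)[OF \<xi>(1)])
  have ne: "(UNIV :: (real ^ 'n) set) \<times> prob_on U \<noteq> {}"
    using \<xi>1.not_empty P2_relaxedD(3)[OF \<xi>(1)] by simp
  have sub: "UNIV \<times> prob_on U \<subseteq> V_space U"
    using prob_on_subset_signed_radon[OF U] by (auto simp: V_space_def)
  obtain G where G: "G \<in> Lip1 (V_space U) (V_dist U)"
      "\<And>v. v \<in> (UNIV :: (real ^ 'n) set) \<times> prob_on U \<Longrightarrow> G v = (\<integral>p. f p \<partial>fibre_measure U v)"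
    using Lip1_McShane_extension[OF sub ne Lip1_integral_fibre_measure[OF f bound] V_dist_commute
        V_dist_triangle V_dist_self] sub by blast
  \<comment> \<open>Integrals over \<open>\<xi>\<close> see \<open>G\<close> only on
    \<open>UNIV \<times> prob_on U\<close>, where it equals the fibre integral of
    \<open>f\<close>.\<close>
  have sm: "signed_measure ?E (measure (average U \<xi>))"
    and int: "signed_integral ?E (measure (average U \<xi>)) f = (\<integral>v. G v \<partial>\<xi>)"
    if "\<xi> \<in> P2_relaxed U" for \<xi>
  proof -
    note avg = average_eq_bind[OF clU that]
    have fin: "finite_measure (average U \<xi>)"
      by (rule prob_space.finite_measure[OF avg(2)])
    show "signed_measure ?E (measure (average U \<xi>))"
      using finite_measure.signed_measure_measure[OF fin] avg(3) by (simp add: signed_measure_def)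
    show "signed_integral ?E (measure (average U \<xi>)) f = (\<integral>v. G v \<partial>\<xi>)"
      unfolding signed_integral_measure[OF fin avg(3)] integral_average[OF clU that meas bound]
      by (intro Bochner_Integration.integral_cong) (simp_all add: G(2) P2_relaxedD(3)[OF that])
  qed
  have "signed_integral ?E (\<lambda>A. measure (average U \<xi>1) A - measure (average U \<xi>2) A) f =
    (\<integral>v. G v \<partial>\<xi>1) - (\<integral>v. G v \<partial>\<xi>2)"
    using signed_integral_diff[OF sm[OF \<xi>(1)] sm[OF \<xi>(2)] meas bound] int[OF \<xi>(1)] int[OF \<xi>(2)]
    by simp
  also have "\<dots> \<le> KR_dist U \<xi>1 \<xi>2"
    unfolding KR_dist_def by (rule cSUP_upper[OF G(1) bdd_above_KR[OF U \<xi>]])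
  finally show "signed_integral ?E (\<lambda>A. measure (average U \<xi>1) A - measure (average U \<xi>2) A) f \<le>
    KR_dist U \<xi>1 \<xi>2" .
qed

theorem lemma2p2:
  fixes U :: "'b::banach set"
    and h :: "((real ^ 'n) \<times> 'b) measure \<Rightarrow> real"
  assumes "compact U"
    and "Lipschitz_continuous_wrt (P2_states U) (fm_dist_K U) h"
  shows "Lipschitz_continuous_wrt (P2_relaxed U) (KR_dist U) (extend U h)"
proof -
  obtain L where L: "L \<ge> 0" "\<And>\<rho>1 \<rho>2. \<rho>1 \<in> P2_states U \<Longrightarrow> \<rho>2 \<in> P2_states U \<Longrightarrow>
      \<bar>h \<rho>1 - h \<rho>2\<bar> \<le> L * fm_dist_K U \<rho>1 \<rho>2"
    using assms(2) by (auto simp: Lipschitz_continuous_wrt_def)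
  have "\<bar>extend U h \<xi>1 - extend U h \<xi>2\<bar> \<le> L * KR_dist U \<xi>1 \<xi>2"
    if \<xi>: "\<xi>1 \<in> P2_relaxed U" "\<xi>2 \<in> P2_relaxed U" for \<xi>1 \<xi>2
  proof -
    have "\<bar>h (average U \<xi>1) - h (average U \<xi>2)\<bar> \<le> L * fm_dist_K U (average U \<xi>1) (average U \<xi>2)"
      by (intro L(2) average_in_P2_states assms(1) \<xi>)
    also have "\<dots> \<le> L * KR_dist U \<xi>1 \<xi>2"
      using L(1) by (intro mult_left_mono fm_dist_K_average_le_KR_dist assms(1) \<xi>)
    finally show ?thesis by (simp add: extend_def)
  qed
  with L(1) show ?thesis
    unfolding Lipschitz_continuous_wrt_def by blast
qed

end
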